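(* For every $\varepsilon>0$ there is a constant $C(\varepsilon)>0$ such that for all $Q,N\in\mathbb{N}$ and every sequence $(a_n)_{n\in\mathbb{Z}[i]}$ of complex numbers, $$\sum_{\substack{q\in\mathbb{Z}[i]\setminus\{0\}\\ \mathcal{N}(q)\le Q}}\ \sum_{\substack{a\bmod q^2\\ (a,q)=1}}\Big|\sum_{\substack{n\in\mathbb{Z}[i]\\ \mathcal{N}(n)\le N}}a_n\, e\Big(\Re\Big(\frac{na}{q^2}\Big)\Big)\Big|^2\le C(\varepsilon)(QN)^{\varepsilon}\big(Q^3+Q^2\sqrt{N}+N\big)Z,$$ where $Z=\sum_{n\in\mathbb{Z}[i],\ \mathcal{N}(n)\le N}|a_n|^2$.
   Context: $e(x)=e^{2\pi i x}$. $\mathbb{Z}[i]$ denotes the Gaussian integers and $\mathcal{N}(q)=\Re(q)^2+\Im(q)^2$. "$a\bmod q^2$, $(a,q)=1$" means $a$ runs over a complete system of residues modulo $q^2$ in $\mathbb{Z}[i]$ with $a$ coprime to $q$. *)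

theory Defs
  imports "HOL-Analysis.Analysis"
begin

definition gauss_ints :: "complex set" where
  "gauss_ints = {z. Re z \<in> \<int> \<and> Im z \<in> \<int>}"

definition gnorm :: "complex \<Rightarrow> real" where
  "gnorm q = (Re q)^2 + (Im q)^2"

definition gdvd :: "complex \<Rightarrow> complex \<Rightarrow> bool" where
  "gdvd d a \<longleftrightarrow> (\<exists>k\<in>gauss_ints. a = d * k)"

definition gunit :: "complex \<Rightarrow> bool" where
  "gunit u \<longleftrightarrow> u \<in> gauss_ints \<and> gnorm u = 1"

definition gcoprime :: "complex \<Rightarrow> complex \<Rightarrow> bool" where
  "gcoprime a b \<longleftrightarrow> (\<forall>d\<in>gauss_ints. gdvd d a \<and> gdvd d b \<longrightarrow> gunit d)"

definition gcong :: "complex \<Rightarrow> complex \<Rightarrow> complex \<Rightarrow> bool" where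
  "gcong a b m \<longleftrightarrow> gdvd m (a - b)"

definition reduced_residue_system :: "complex \<Rightarrow> complex set \<Rightarrow> bool" where
  "reduced_residue_system q R \<longleftrightarrow>
     R \<subseteq> gauss_ints \<and> (\<forall>a\<in>R. gcoprime a q) \<and>
     (\<forall>a\<in>R. \<forall>b\<in>R. gcong a b (q^2) \<longrightarrow> a = b) \<and>
     (\<forall>a\<in>gauss_ints. gcoprime a q \<longrightarrow> (\<exists>b\<in>R. gcong a b (q^2)))"

definition ee :: "real \<Rightarrow> complex" where
  "ee x = exp (2 * pi * \<i> * complex_of_real x)"

end

theory Submission
  imports Defs
begin

text \<open>By duality, the large sieve reduces the theorem to counting, for an arbitrary \<open>\<alpha>\<close>, the
  fractions \<open>a / q\<^sup>2\<close> with \<open>N(q) \<le> Q\<close> at distance \<open>O(1 / \<surd>N)\<close> from \<open>\<alpha>\<close>.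
  Dirichlet approximation gives \<open>b / r\<close> near \<open>\<alpha>\<close> with \<open>|r|\<^sup>2 \<le> 2 \<surd>N\<close>, and
  \<open>m = a r - b q\<^sup>2\<close> is then small. The value \<open>m = 0\<close> leaves a bounded number of \<open>q\<close>.
  For fixed \<open>m \<noteq> 0\<close> the admissible \<open>q\<close> lie in two small discs, and \<open>r\<close> divides
  \<open>(q - q\<^sub>1) (q + q\<^sub>1)\<close> for any two of them. Splitting \<open>r\<close> accordingly reduces their number to
  the number of divisors of \<open>r\<close> in \<open>\<int>[i]\<close>, the only source of the factor \<open>N\<^sup>\<epsilon>\<close>.\<close>

section \<open>Arithmetic of the Gaussian integers\<close>

text \<open>A longer range for |r| raises |r|^2 \<rho>^2 and lowers Dirichlet's bound for |r
  \<alpha> - b|^2; at N^(1/4) both are of order 1 / sqrt N, which becomes Q^2 sqrt N once the sieve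
  multiplies by N. The value m = 0 yields the summand N, and the area of the discs, measured modulo
  \<open>r\<close> and summed over \<open>m\<close>, yields Q^3. The obstacle is a common factor g
  of the two parts u and r/u into which \<open>r\<close> splits: then q is known only modulo r/g,
  and the bound for a single \<open>m\<close> is too weak. The loss is recovered on average over
  \<open>m\<close>, which is why the sum over \<open>m\<close> is interchanged with the sum over the
  divisors of \<open>r\<close>.\<close>

lemma gauss_ints_0 [simp]: "0 \<in> gauss_ints" by (simp add: gauss_ints_def)
lemma gauss_ints_1 [simp]: "1 \<in> gauss_ints" by (simp add: gauss_ints_def)
lemma gauss_ints_2 [simp]: "2 \<in> gauss_ints" by (simp add: gauss_ints_def)

lemma gauss_ints_add [simp]: "x \<in> gauss_ints \<Longrightarrow> y \<in> gauss_ints \<Longrightarrow> x + y \<in> gauss_ints"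
  and gauss_ints_diff [simp]: "x \<in> gauss_ints \<Longrightarrow> y \<in> gauss_ints \<Longrightarrow> x - y \<in> gauss_ints"
  and gauss_ints_mult [simp]: "x \<in> gauss_ints \<Longrightarrow> y \<in> gauss_ints \<Longrightarrow> x * y \<in> gauss_ints"
  and gauss_ints_minus [simp]: "x \<in> gauss_ints \<Longrightarrow> - x \<in> gauss_ints"
  by (simp_all add: gauss_ints_def)

lemma gauss_ints_power [simp]: "x \<in> gauss_ints \<Longrightarrow> x ^ n \<in> gauss_ints"
  by (induction n) simp_all

lemma gnorm_eq_cmod: "gnorm z = (cmod z)\<^sup>2"
  by (simp add: gnorm_def cmod_power2)

lemma gnorm_Ints: "z \<in> gauss_ints \<Longrightarrow> gnorm z \<in> \<int>"
  by (simp add: gauss_ints_def gnorm_def)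

lemma cmod_gauss_ge_1:
  assumes "z \<in> gauss_ints" "z \<noteq> 0"
  shows "1 \<le> cmod z"
proof -
  have "gnorm z > 0" using assms by (simp add: gnorm_eq_cmod)
  with gnorm_Ints[OF assms(1)] have "gnorm z \<ge> 1"
    by (metis Ints_cases of_int_0_less_iff of_int_1_le_iff int_one_le_iff_zero_less)
  then have "1\<^sup>2 \<le> (cmod z)\<^sup>2" by (simp add: gnorm_eq_cmod)
  then show ?thesis by (metis norm_ge_zero power2_le_imp_le)
qed

lemma gauss_round: "\<exists>k\<in>gauss_ints. \<bar>Re (z - k)\<bar> \<le> 1/2 \<and> \<bar>Im (z - k)\<bar> \<le> 1/2"
proof (rule bexI)
  show "Complex (of_int (round (Re z))) (of_int (round (Im z))) \<in> gauss_ints"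
    by (simp add: gauss_ints_def)
  show "\<bar>Re (z - Complex (of_int (round (Re z))) (of_int (round (Im z))))\<bar> \<le> 1/2 \<and>
        \<bar>Im (z - Complex (of_int (round (Re z))) (of_int (round (Im z))))\<bar> \<le> 1/2"
    using of_int_round_abs_le[of "Re z"] of_int_round_abs_le[of "Im z"]
    by (simp add: abs_minus_commute)
qed

section \<open>Lattice points in squares and discs\<close>

lemma gauss_ints_image:
  "{k \<in> gauss_ints. \<bar>Re k\<bar> \<le> Y \<and> \<bar>Im k\<bar> \<le> Y} =
   (\<lambda>(x, y). Complex (of_int x) (of_int y)) ` ({-\<lfloor>Y\<rfloor>..\<lfloor>Y\<rfloor>} \<times> {-\<lfloor>Y\<rfloor>..\<lfloor>Y\<rfloor>})" (is "?A = ?B")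
proof (intro equalityI subsetI)
  fix k assume "k \<in> ?A"
  then obtain x y where xy: "Re k = of_int x" "Im k = of_int y" and "\<bar>Re k\<bar> \<le> Y" "\<bar>Im k\<bar> \<le> Y"
    by (auto simp: gauss_ints_def elim!: Ints_cases)
  then have "\<bar>x\<bar> \<le> \<lfloor>Y\<rfloor>" "\<bar>y\<bar> \<le> \<lfloor>Y\<rfloor>" by (simp_all add: le_floor_iff)
  with xy show "k \<in> ?B" by (auto simp: complex_eq_iff image_iff intro!: bexI[of _ "(x,y)"])
next
  fix k assume "k \<in> ?B"
  then obtain x y where k: "k = Complex (of_int x) (of_int y)" "\<bar>x\<bar> \<le> \<lfloor>Y\<rfloor>" "\<bar>y\<bar> \<le> \<lfloor>Y\<rfloor>" by auto
  then show "k \<in> ?A" by (simp add: gauss_ints_def le_floor_iff)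
qed

lemma gauss_box_card:
  assumes "0 \<le> Y"
  shows "finite {k \<in> gauss_ints. \<bar>Re k\<bar> \<le> Y \<and> \<bar>Im k\<bar> \<le> Y}"
    and "real (card {k \<in> gauss_ints. \<bar>Re k\<bar> \<le> Y \<and> \<bar>Im k\<bar> \<le> Y}) \<le> (2 * Y + 1)\<^sup>2"
proof -
  let ?f = "\<lambda>(x, y). Complex (of_int x) (of_int y)"
  let ?I = "{-\<lfloor>Y\<rfloor>..\<lfloor>Y\<rfloor>}"
  show "finite {k \<in> gauss_ints. \<bar>Re k\<bar> \<le> Y \<and> \<bar>Im k\<bar> \<le> Y}" unfolding gauss_ints_image by simp
  have "card (?f ` (?I \<times> ?I)) \<le> card (?I \<times> ?I)" by (intro card_image_le) simp
  also have "\<dots> = (card ?I)\<^sup>2" by (simp add: card_cartesian_product power2_eq_square)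
  finally have "real (card (?f ` (?I \<times> ?I))) \<le> (real (card ?I))\<^sup>2"
    by (metis of_nat_le_iff of_nat_power)
  also have "\<dots> \<le> (2 * Y + 1)\<^sup>2"
  proof (rule power_mono)
    have "real (card ?I) = 2 * of_int \<lfloor>Y\<rfloor> + 1" using assms by simp
    then show "real (card ?I) \<le> 2 * Y + 1" by linarith
  qed simp
  finally show "real (card {k \<in> gauss_ints. \<bar>Re k\<bar> \<le> Y \<and> \<bar>Im k\<bar> \<le> Y}) \<le> (2 * Y + 1)\<^sup>2"
    unfolding gauss_ints_image .
qed

lemma gauss_ball_subset_box:
  "{k \<in> gauss_ints. cmod k \<le> Y} \<subseteq> {k \<in> gauss_ints. \<bar>Re k\<bar> \<le> Y \<and> \<bar>Im k\<bar> \<le> Y}"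
  using abs_Re_le_cmod abs_Im_le_cmod order_trans by blast

lemma finite_gauss_ball: "finite {k \<in> gauss_ints. cmod k \<le> Y}"
proof (cases "0 \<le> Y")
  case True
  then show ?thesis using gauss_ball_subset_box gauss_box_card(1) finite_subset by blast
next
  case False
  then have "{k \<in> gauss_ints. cmod k \<le> Y} = {}" using norm_ge_zero order_trans by blast
  then show ?thesis by (metis finite.emptyI)
qed

lemma card_gauss_ball:
  assumes "0 \<le> Y"
  shows "real (card {k \<in> gauss_ints. cmod k \<le> Y}) \<le> (2 * Y + 1)\<^sup>2"
proof -
  have "card {k \<in> gauss_ints. cmod k \<le> Y} \<le> card {k \<in> gauss_ints. \<bar>Re k\<bar> \<le> Y \<and> \<bar>Im k\<bar> \<le> Y}"
    using gauss_ball_subset_box gauss_box_card(1)[OF assms] by (intro card_mono)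
  then show ?thesis using gauss_box_card(2)[OF assms] by linarith
qed

text \<open>Nonzero Gaussian integers have modulus at least 1, so for Y < 1 the set is empty, and
  for Y >= 1 the bound for the full disc is at most (3Y)^2. The missing constant term matters: the
  number of \<open>m\<close> has to vanish together with the range allowed to them.\<close>

lemma card_gauss_ball_nonzero:
  assumes "0 \<le> Y"
  shows "real (card {k \<in> gauss_ints. k \<noteq> 0 \<and> cmod k \<le> Y}) \<le> 9 * Y\<^sup>2"
proof (cases "1 \<le> Y")
  case True
  have "card {k \<in> gauss_ints. k \<noteq> 0 \<and> cmod k \<le> Y} \<le> card {k \<in> gauss_ints. cmod k \<le> Y}"
    by (intro card_mono finite_gauss_ball) auto
  then have "real (card {k \<in> gauss_ints. k \<noteq> 0 \<and> cmod k \<le> Y}) \<le> (2 * Y + 1)\<^sup>2"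
    using card_gauss_ball[OF assms] by linarith
  also have "\<dots> \<le> (3 * Y)\<^sup>2" using True by (intro power_mono) auto
  finally show ?thesis by (simp add: power_mult_distrib)
next
  case False
  then have "{k \<in> gauss_ints. k \<noteq> 0 \<and> cmod k \<le> Y} = {}"
    using cmod_gauss_ge_1 by force
  then have "card {k \<in> gauss_ints. k \<noteq> 0 \<and> cmod k \<le> Y} = 0" by (metis card.empty)
  then show ?thesis by simp
qed

section \<open>Divisibility, Bezout identities and the splitting of divisors\<close>

lemma gdvd_mult_right: "gdvd d a \<Longrightarrow> c \<in> gauss_ints \<Longrightarrow> gdvd d (a * c)"
  unfolding gdvd_def by (metis gauss_ints_mult mult.assoc)

lemma gdvd_mult_left: "gdvd d a \<Longrightarrow> c \<in> gauss_ints \<Longrightarrow> gdvd d (c * a)"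
  using gdvd_mult_right by (simp add: mult.commute)

lemma gdvd_triv [simp]: "c \<in> gauss_ints \<Longrightarrow> gdvd d (d * c)"
  unfolding gdvd_def by blast

lemma gdvd_refl [simp]: "gdvd d d"
  unfolding gdvd_def by (metis gauss_ints_1 mult.right_neutral)

lemma gdvd_trans: "gdvd a b \<Longrightarrow> gdvd b c \<Longrightarrow> gdvd a c"
  unfolding gdvd_def by (metis gauss_ints_mult mult.assoc)

lemma gdvd_add: "gdvd d a \<Longrightarrow> gdvd d b \<Longrightarrow> gdvd d (a + b)"
  unfolding gdvd_def by (metis distrib_left gauss_ints_add)

lemma gdvd_diff: "gdvd d a \<Longrightarrow> gdvd d b \<Longrightarrow> gdvd d (a - b)"
  unfolding gdvd_def by (metis right_diff_distrib gauss_ints_diff)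

lemma gdvd_mult_mono: "gdvd a b \<Longrightarrow> gdvd c d \<Longrightarrow> gdvd (a * c) (b * d)"
  by (auto simp: gdvd_def intro!: bexI[OF _ gauss_ints_mult])

lemma gdvd_mult_cancel: "c \<noteq> 0 \<Longrightarrow> gdvd (c * a) (c * b) \<longleftrightarrow> gdvd a b"
  unfolding gdvd_def by (simp add: mult.assoc)

lemma gdvd_imp_cmod_le:
  assumes "gdvd d a" "a \<noteq> 0"
  shows "cmod d \<le> cmod a"
proof -
  obtain k where k: "k \<in> gauss_ints" "a = d * k" using assms by (auto simp: gdvd_def)
  then have "1 \<le> cmod k" using assms(2) by (intro cmod_gauss_ge_1) auto
  then show ?thesis using k by (simp add: norm_mult mult_le_cancel_left1)
qed

text \<open>A nonzero combination of least modulus divides every other one, because rounding the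
  quotient leaves a remainder that is again a combination and is strictly shorter.\<close>

lemma gauss_bezout:
  assumes u: "u \<in> gauss_ints" and s: "s \<in> gauss_ints" and nz: "u \<noteq> 0 \<or> s \<noteq> 0"
  obtains g x y where "g \<in> gauss_ints" "x \<in> gauss_ints" "y \<in> gauss_ints" "g \<noteq> 0"
    "g = x * u + y * s" "gdvd g u" "gdvd g s"
proof -
  define I where "I = {z. z \<noteq> 0 \<and> (\<exists>x\<in>gauss_ints. \<exists>y\<in>gauss_ints. z = x * u + y * s)}"
  have comb: "x * u + y * s \<noteq> 0 \<Longrightarrow> x * u + y * s \<in> I" if "x \<in> gauss_ints" "y \<in> gauss_ints" for x y
    using that unfolding I_def by blast
  have IG: "I \<subseteq> gauss_ints" using u s unfolding I_def by auto
  obtain z0 where z0: "z0 \<in> I"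
    using nz comb[of 1 0] comb[of 0 1] by auto
  have fin: "finite {z \<in> I. cmod z \<le> cmod z0}"
    by (rule finite_subset[OF _ finite_gauss_ball[of "cmod z0"]]) (use IG in auto)
  obtain g where g: "g \<in> I" and gmin0: "\<And>z. z \<in> I \<Longrightarrow> cmod z \<le> cmod z0 \<Longrightarrow> cmod g \<le> cmod z"
    using ex_is_arg_min_if_finite[OF fin, of cmod] z0 unfolding is_arg_min_linorder by auto
  have gz0: "cmod g \<le> cmod z0" using gmin0[OF z0] by simp
  have gmin: "cmod g \<le> cmod z" if "z \<in> I" for z
    using gmin0[OF that] gz0 by linarith
  obtain x y where xy: "x \<in> gauss_ints" "y \<in> gauss_ints" "g = x * u + y * s" "g \<noteq> 0"
    using g unfolding I_def by auto
  have gd: "gdvd g w" if w: "w = p * u + q * s" "p \<in> gauss_ints" "q \<in> gauss_ints" for w p q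
  proof -
    obtain k where k: "k \<in> gauss_ints" "\<bar>Re (w / g - k)\<bar> \<le> 1/2" "\<bar>Im (w / g - k)\<bar> \<le> 1/2"
      using gauss_round by blast
    define e where "e = w - g * k"
    have "e = (p - x * k) * u + (q - y * k) * s" using w xy by (simp add: e_def algebra_simps)
    then have eI: "e \<noteq> 0 \<Longrightarrow> e \<in> I" using comb[of "p - x*k" "q - y * k"] w xy k by simp
    have "cmod (w / g - k) < 1"
    proof -
      have "(cmod (w / g - k))\<^sup>2 = (Re (w / g - k))\<^sup>2 + (Im (w / g - k))\<^sup>2" by (rule cmod_power2)
      also have "\<dots> \<le> (1/2)\<^sup>2 + (1/2)\<^sup>2"
        using k(2,3) by (intro add_mono) (auto simp: power2_le_iff_abs_le simp del: minus_complex.sel)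
      also have "\<dots> < 1\<^sup>2" by (simp add: power2_eq_square)
      finally show ?thesis by (rule power2_less_imp_less) simp
    qed
    then have "cmod g * cmod (w / g - k) < cmod g" using xy(4) by simp
    moreover have "g * (w / g - k) = e" using xy(4) by (simp add: e_def field_simps)
    ultimately have "cmod e < cmod g" by (metis norm_mult)
    then have "e = 0" using eI gmin by force
    then show ?thesis using k by (simp add: e_def)
  qed
  have "g \<in> gauss_ints" using g IG by blast
  moreover have "gdvd g u" using gd[of u 1 0] by simp
  moreover have "gdvd g s" using gd[of s 0 1] by simp
  ultimately show ?thesis using that xy by blast
qed

text \<open>The gcd from \<open>gauss_bezout\<close> is a unit, and its inverse is its conjugate;
  multiplying by it turns the combination into 1.\<close>

lemma gcoprime_bezout:
  assumes "a \<in> gauss_ints" "b \<in> gauss_ints" "gcoprime a b" "b \<noteq> 0"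
  obtains x y where "x \<in> gauss_ints" "y \<in> gauss_ints" "1 = x * a + y * b"
proof -
  obtain g x y where g: "g \<in> gauss_ints" "x \<in> gauss_ints" "y \<in> gauss_ints" "g \<noteq> 0"
    "g = x * a + y * b" "gdvd g a" "gdvd g b"
    using gauss_bezout[OF assms(1,2)] assms(4) by blast
  then have "gunit g" using assms unfolding gcoprime_def by blast
  then have "g * cnj g = 1" using complex_norm_square[of g] by (simp add: gunit_def gnorm_eq_cmod)
  moreover have c: "cnj g \<in> gauss_ints" using g(1) by (simp add: gauss_ints_def)
  ultimately have "1 = (x * cnj g) * a + (y * cnj g) * b"
    using g(5) by (simp add: algebra_simps)
  then show ?thesis using that[of "x * cnj g" "y * cnj g"] g c by simp
qed

text \<open>Multiply the Bezout identity by \<open>c\<close>. Coprimality enters as such an identity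
  because the pairs in question, such as cofactors of a gcd or a numerator and a squared
  denominator, come with one.\<close>

lemma gdvd_cancel_coprime:
  assumes "1 = x * a + y * d" "x \<in> gauss_ints" "y \<in> gauss_ints" "c \<in> gauss_ints" "gdvd d (a * c)"
  shows "gdvd d c"
proof -
  have "c = (x * a + y * d) * c" using assms(1) by simp
  also have "\<dots> = x * (a * c) + d * (y * c)" by (simp add: algebra_simps)
  finally have eq: "c = x * (a * c) + d * (y * c)" .
  have "gdvd d (x * (a * c) + d * (y * c))"
    by (intro gdvd_add gdvd_mult_left[OF assms(5)] gdvd_triv gauss_ints_mult assms)
  then show ?thesis using eq by simp
qed

text \<open>Take u1 = gcd(u, s). The cofactor u / u1 is coprime to s / u1 and divides (s / u1) t, so
  it divides \<open>t\<close>. This plays the role of unique factorization.\<close>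

lemma gdvd_mult_split:
  assumes "u \<in> gauss_ints" "s \<in> gauss_ints" "t \<in> gauss_ints" "u \<noteq> 0 \<or> s \<noteq> 0" "gdvd u (s * t)"
  obtains u1 u2 where "u1 \<in> gauss_ints" "u2 \<in> gauss_ints" "u = u1 * u2" "gdvd u1 s" "gdvd u2 t"
proof -
  obtain g x y where g: "g \<in> gauss_ints" "x \<in> gauss_ints" "y \<in> gauss_ints" "g \<noteq> 0"
    "g = x * u + y * s" "gdvd g u" "gdvd g s"
    using gauss_bezout[OF assms(1,2)] assms(4) by blast
  obtain u' s' where u': "u' \<in> gauss_ints" "u = g * u'" and s': "s' \<in> gauss_ints" "s = g * s'"
    using g(6,7) unfolding gdvd_def by auto
  have "g * 1 = g * (y * s' + x * u')" using g(5) u'(2) s'(2) by (simp add: algebra_simps)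
  then have "1 = y * s' + x * u'" using g(4) mult_left_cancel by blast
  moreover have "gdvd u' (s' * t)"
    using assms(5) unfolding u'(2) s'(2) by (simp add: mult.assoc gdvd_mult_cancel[OF g(4)])
  ultimately have "gdvd u' t" using gdvd_cancel_coprime[OF _ g(3,2) assms(3)] by blast
  then show ?thesis using that[OF g(1) u'(1,2) g(7)] by blast
qed

section \<open>The divisor bound\<close>

text \<open>Associates are kept apart; for nonzero \<open>r\<close> this only multiplies the usual
  divisor count by the number of units.\<close>

definition gdivisors :: "complex \<Rightarrow> complex set" where
  "gdivisors r = {u \<in> gauss_ints. gdvd u r}"

lemma finite_gdivisors: "r \<noteq> 0 \<Longrightarrow> finite (gdivisors r)"
  by (rule finite_subset[OF _ finite_gauss_ball[of "cmod r"]])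
     (auto simp: gdivisors_def gdvd_imp_cmod_le)

lemma card_gdivisors_mult:
  assumes "s \<in> gauss_ints" "t \<in> gauss_ints" "s \<noteq> 0" "t \<noteq> 0"
  shows "card (gdivisors (s * t)) \<le> card (gdivisors s) * card (gdivisors t)"
proof -
  let ?f = "\<lambda>(u, v). u * v :: complex"
  have "gdivisors (s * t) \<subseteq> ?f ` (gdivisors s \<times> gdivisors t)"
  proof
    fix u assume "u \<in> gdivisors (s * t)"
    then have u: "u \<in> gauss_ints" "gdvd u (s * t)" by (auto simp: gdivisors_def)
    obtain u1 u2 where "u1 \<in> gauss_ints" "u2 \<in> gauss_ints" "u = u1 * u2" "gdvd u1 s" "gdvd u2 t"
      using gdvd_mult_split[OF u(1) assms(1,2) disjI2[OF assms(3)] u(2)] .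
    then show "u \<in> ?f ` (gdivisors s \<times> gdivisors t)"
      by (intro image_eqI[of _ _ "(u1, u2)"]) (auto simp: gdivisors_def)
  qed
  then have "card (gdivisors (s * t)) \<le> card (gdivisors s \<times> gdivisors t)"
    using assms by (intro surj_card_le) (simp_all add: finite_gdivisors)
  then show ?thesis by (simp add: card_cartesian_product)
qed

lemma gdivisors_cofactor:
  assumes "u \<in> gdivisors r" "r \<noteq> 0"
  shows "u \<in> gauss_ints" "u \<noteq> 0" "r / u \<in> gauss_ints" "u * (r / u) = r"
  using assms by (auto simp: gdivisors_def gdvd_def)

definition gauss_units :: "complex set" where
  "gauss_units = {u \<in> gauss_ints. cmod u = 1}"

lemma finite_gauss_units: "finite gauss_units"
  by (rule finite_subset[OF _ finite_gauss_ball[of 1]]) (auto simp: gauss_units_def)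

lemma card_gauss_units: "card gauss_units \<le> 9"
proof -
  have "card gauss_units \<le> card {k \<in> gauss_ints. cmod k \<le> 1}"
    by (intro card_mono finite_gauss_ball) (auto simp: gauss_units_def)
  with card_gauss_ball[of 1] show ?thesis by simp
qed

lemma gauss_units_mult: "u \<in> gauss_units \<Longrightarrow> v \<in> gauss_units \<Longrightarrow> u * v \<in> gauss_units"
  by (simp add: gauss_units_def norm_mult)

text \<open>Peeling off one factor \<open>p\<close> at a time shows that every divisor is a unit
  times p^j with j <= k. Irreducibility is phrased through moduli: a divisor of modulus |p| has a
  cofactor of modulus 1, so it is an associate of \<open>p\<close>.\<close>

lemma card_gdivisors_prime_power:
  assumes p: "p \<in> gauss_ints" "p \<noteq> 0"
    and irr: "\<And>u. u \<in> gauss_ints \<Longrightarrow> gdvd u p \<Longrightarrow> cmod u = 1 \<or> cmod u = cmod p"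
  shows "card (gdivisors (p ^ k)) \<le> 9 * (k + 1)"
proof -
  have mem: "\<exists>j\<le>k. \<exists>e\<in>gauss_units. u = e * p ^ j" if "u \<in> gauss_ints" "gdvd u (p ^ k)" for u
    using that
  proof (induction k arbitrary: u)
    case 0
    then have "cmod u \<le> 1" "u \<noteq> 0" using gdvd_imp_cmod_le[of u 1] by (auto simp: gdvd_def)
    then have "u \<in> gauss_units" using 0 cmod_gauss_ge_1[of u] by (simp add: gauss_units_def)
    then show ?case by auto
  next
    case (Suc k)
    have "gdvd u (p * p ^ k)" using Suc.prems by simp
    then obtain u1 u2 where u: "u1 \<in> gauss_ints" "u2 \<in> gauss_ints" "u = u1 * u2" "gdvd u1 p" "gdvd u2 (p ^ k)"
      using gdvd_mult_split[of u p "p ^ k"] Suc.prems p by (metis gauss_ints_power)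
    obtain j e where je: "j \<le> k" "e \<in> gauss_units" "u2 = e * p ^ j"
      using Suc.IH[OF u(2,5)] by blast
    show ?case
    proof (cases "cmod u1 = 1")
      case True
      then have "e * u1 \<in> gauss_units" using je u by (simp add: gauss_units_def norm_mult)
      moreover have "u = (e * u1) * p ^ j" using u je by simp
      ultimately show ?thesis
        using je(1) by (intro exI[of _ j] conjI bexI[of _ "e * u1"]) auto
    next
      case False
      then have c: "cmod u1 = cmod p" using irr u by blast
      obtain w where w: "w \<in> gauss_ints" "p = u1 * w" using u(4) by (auto simp: gdvd_def)
      have w1: "cmod w = 1" using c w(2) p(2) by (simp add: norm_mult)
      then have ww: "w * cnj w = 1" using complex_norm_square[of w] by simp
      have "cnj w \<in> gauss_units" using w w1 by (simp add: gauss_units_def gauss_ints_def)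
      then have "e * cnj w \<in> gauss_units" using je gauss_units_mult by blast
      moreover have "u = (e * cnj w) * p ^ Suc j"
      proof -
        have "p * cnj w = u1" using w(2) ww by (simp add: mult.assoc)
        then show ?thesis using u(3) je(3) by (simp add: algebra_simps)
      qed
      ultimately show ?thesis
        using je(1) by (intro exI[of _ "Suc j"] conjI bexI[of _ "e * cnj w"]) auto
    qed
  qed
  let ?f = "\<lambda>(j, e). e * p ^ j"
  have "gdivisors (p ^ k) \<subseteq> ?f ` ({..k} \<times> gauss_units)"
    using mem by (fastforce simp: gdivisors_def)
  then have "card (gdivisors (p ^ k)) \<le> card ({..k} \<times> gauss_units)"
    by (intro surj_card_le) (simp_all add: finite_gauss_units)
  also have "\<dots> = (k + 1) * card gauss_units" by (simp add: card_cartesian_product)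
  also have "\<dots> \<le> (k + 1) * 9" using card_gauss_units by (intro mult_left_mono) auto
  finally show ?thesis by simp
qed

text \<open>The norm is an integer exceeding 1. The uniform gap gives geometric growth of |p|^k even
  at the smallest primes.\<close>

lemma cmod_nonunit_ge_sqrt2:
  assumes "p \<in> gauss_ints" "1 < cmod p"
  shows "sqrt 2 \<le> cmod p"
proof -
  obtain n where n: "gnorm p = of_int n" using gnorm_Ints[OF assms(1)] by (auto elim: Ints_cases)
  have "1\<^sup>2 < (cmod p)\<^sup>2" using assms(2) by (intro power_strict_mono) auto
  then have "2 \<le> gnorm p" using n by (simp add: gnorm_eq_cmod)
  then show ?thesis by (intro real_le_lsqrt) (auto simp: gnorm_eq_cmod)
qed

text \<open>Strong induction on the norm; the floor merely turns this nonnegative integer, stored as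
  a real, into a natural number.\<close>

lemma gauss_induct [consumes 1, case_names less]:
  assumes "r \<in> gauss_ints"
    and step: "\<And>r. r \<in> gauss_ints \<Longrightarrow> (\<And>s. s \<in> gauss_ints \<Longrightarrow> cmod s < cmod r \<Longrightarrow> P s) \<Longrightarrow> P r"
  shows "P r"
  using assms(1)
proof (induction "nat \<lfloor>gnorm r\<rfloor>" arbitrary: r rule: less_induct)
  case less
  show ?case
  proof (rule step[OF less.prems])
    fix s assume s: "s \<in> gauss_ints" "cmod s < cmod r"
    obtain m n where mn: "gnorm s = of_int m" "gnorm r = of_int n"
      using gnorm_Ints[OF s(1)] gnorm_Ints[OF less.prems] by (auto elim!: Ints_cases)
    have "gnorm s < gnorm r" using s(2) by (simp add: gnorm_eq_cmod power_strict_mono)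
    moreover have "0 \<le> gnorm s" by (simp add: gnorm_def)
    ultimately have "nat \<lfloor>gnorm s\<rfloor> < nat \<lfloor>gnorm r\<rfloor>" using mn by simp
    then show "P s" using less.hyps s by blast
  qed
qed

lemma gauss_multiplicity:
  assumes "r \<in> gauss_ints" "p \<in> gauss_ints" "1 < cmod p" "r \<noteq> 0"
  shows "\<exists>k. \<exists>s\<in>gauss_ints. r = p ^ k * s \<and> \<not> gdvd p s"
  using assms(1,4)
proof (induction r rule: gauss_induct)
  case (less r)
  show ?case
  proof (cases "gdvd p r")
    case True
    then obtain s where s: "s \<in> gauss_ints" "r = p * s" by (auto simp: gdvd_def)
    then have "s \<noteq> 0" "cmod s < cmod r" using less.prems assms(3) by (auto simp: norm_mult)
    then obtain k t where "t \<in> gauss_ints" "s = p ^ k * t" "\<not> gdvd p t" using less.IH s by blast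
    then show ?thesis using s(2) by (intro exI[of _ "Suc k"]) auto
  next
    case False
    then show ?thesis using less.hyps by (intro exI[of _ 0]) auto
  qed
qed

lemma gauss_irreducible_divisor:
  assumes "r \<in> gauss_ints" "1 < cmod r"
  obtains p where "p \<in> gauss_ints" "1 < cmod p" "gdvd p r"
    "\<And>u. u \<in> gauss_ints \<Longrightarrow> gdvd u p \<Longrightarrow> cmod u = 1 \<or> cmod u = cmod p"
proof -
  have "\<exists>p\<in>gauss_ints. 1 < cmod p \<and> gdvd p r \<and>
      (\<forall>u\<in>gauss_ints. gdvd u p \<longrightarrow> cmod u = 1 \<or> cmod u = cmod p)"
    using assms
  proof (induction r rule: gauss_induct)
    case (less r)
    show ?case
    proof (cases "\<forall>u\<in>gauss_ints. gdvd u r \<longrightarrow> cmod u = 1 \<or> cmod u = cmod r")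
      case True
      then show ?thesis using less.hyps less.prems gdvd_refl by blast
    next
      case False
      then obtain u where u: "u \<in> gauss_ints" "gdvd u r" "cmod u \<noteq> 1" "cmod u \<noteq> cmod r" by blast
      have "r \<noteq> 0" using less.prems by auto
      then have "u \<noteq> 0" "cmod u \<le> cmod r" using u(2) gdvd_imp_cmod_le by (auto simp: gdvd_def)
      then have "1 < cmod u" "cmod u < cmod r" using u cmod_gauss_ge_1[of u] by auto
      then show ?thesis using less.IH[OF u(1)] gdvd_trans[OF _ u(2)] by blast
    qed
  qed
  then show ?thesis using that by blast
qed

text \<open>The factor \<^term>\<open>A\<close> is paid once for each of the finitely many small primes dividing
  \<^term>\<open>r\<close>; a large prime \<^term>\<open>p\<close> satisfies \<^prop>\<open>18 \<le> cmod p powr \<epsilon>\<close>, which absorbs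
  the contribution \<open>9 (k + 1) \<le> 18\<^sup>k\<close> of its \<open>k\<close>-th power.\<close>

lemma gauss_divisor_bound:
  assumes "0 < \<epsilon>"
  shows "\<exists>C>0. \<forall>r\<in>gauss_ints. r \<noteq> 0 \<longrightarrow> real (card (gdivisors r)) \<le> C * cmod r powr \<epsilon>"
proof -
  \<comment> \<open>\<open>c\<close> bounds |p|^\<epsilon> from below for every nonzero nonunit, and
    Bernoulli gives k + 1 <= (1 + 1/(c - 1)) c^k; hence the form of \<open>A\<close>.\<close>
  define c where "c = sqrt 2 powr \<epsilon>"
  define A where "A = 9 * (1 + 1 / (c - 1))"
  define S where "S = {p \<in> gauss_ints. 1 < cmod p \<and> cmod p \<le> 18 powr (1 / \<epsilon>)}"
  \<comment> \<open>Associated primes are counted separately. What matters is that \<open>w\<close>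
    is bounded by \<open>card S\<close> and grows when a prime of \<open>S\<close> enters the
    factorization.\<close>
  define w where "w r = card {p \<in> S. gdvd p r}" for r
  have finS: "finite S"
    unfolding S_def by (rule finite_subset[OF _ finite_gauss_ball[of "18 powr (1 / \<epsilon>)"]]) auto
  have c1: "1 < c" unfolding c_def using assms by (intro gr_one_powr) auto
  then have A1: "1 \<le> A" by (simp add: A_def)
  have wS: "w r \<le> card S" for r unfolding w_def using finS by (intro card_mono) auto
  have small: "9 * (real k + 1) \<le> A * (cmod p powr \<epsilon>) ^ k" if "p \<in> gauss_ints" "1 < cmod p" for p k
  proof -
    have "1 + real k * (c - 1) \<le> c ^ k"
      using Bernoulli_inequality[of "c - 1" k] c1 by simp
    then have k: "real k \<le> c ^ k / (c - 1)" and "1 \<le> c ^ k"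
      using c1 by (simp_all add: pos_le_divide_eq)
    then have "real k + 1 \<le> (1 + 1 / (c - 1)) * c ^ k"
      by (simp add: algebra_simps)
    then have "9 * (real k + 1) \<le> 9 * ((1 + 1 / (c - 1)) * c ^ k)" by (rule mult_left_mono) simp
    also have "\<dots> = A * c ^ k" by (simp only: A_def mult.assoc)
    also have "\<dots> \<le> A * (cmod p powr \<epsilon>) ^ k"
      unfolding c_def using A1 cmod_nonunit_ge_sqrt2[OF that] assms
      by (intro mult_left_mono power_mono powr_mono2) auto
    finally show ?thesis .
  qed
  have large: "9 * (real k + 1) \<le> (cmod p powr \<epsilon>) ^ k"
    if "p \<in> gauss_ints" "1 < cmod p" "p \<notin> S" "1 \<le> k" for p k
  proof -
    have "18 powr (1 / \<epsilon>) < cmod p" using that by (auto simp: S_def)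
    then have "(18 powr (1 / \<epsilon>)) powr \<epsilon> \<le> cmod p powr \<epsilon>" using assms by (intro powr_mono2) auto
    then have p18: "18 \<le> cmod p powr \<epsilon>" using assms by (simp add: powr_powr)
    have "9 * (real k + 1) \<le> 18 * real k" using that by simp
    also have "\<dots> \<le> 18 ^ k"
    proof -
      have "18 * n \<le> 18 ^ n" if "1 \<le> n" for n :: nat
        using that by (induction n rule: dec_induct) auto
      then have "18 * k \<le> 18 ^ k" using that by blast
      then have "real (18 * k) \<le> real (18 ^ k)" by (rule of_nat_mono)
      then show ?thesis by simp
    qed
    also have "\<dots> \<le> (cmod p powr \<epsilon>) ^ k" using p18 by (intro power_mono) auto
    finally show ?thesis .
  qed
  have main: "real (card (gdivisors r)) \<le> 9 * A ^ w r * cmod r powr \<epsilon>"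
    if "r \<in> gauss_ints" "r \<noteq> 0" for r
    using that
  proof (induction r rule: gauss_induct)
    case (less r)
    have r1: "1 \<le> cmod r" using cmod_gauss_ge_1 less by blast
    show ?case
    proof (cases "1 < cmod r")
      case False
      then have r: "cmod r = 1" using r1 by simp
      have "gdivisors r \<subseteq> gauss_units"
      proof
        fix u assume u: "u \<in> gdivisors r"
        note co = gdivisors_cofactor[OF u less.prems]
        have "gdvd u r" using u by (simp add: gdivisors_def)
        then have "cmod u \<le> 1" using gdvd_imp_cmod_le less.prems r by metis
        then show "u \<in> gauss_units"
          using cmod_gauss_ge_1[OF co(1,2)] co(1) by (simp add: gauss_units_def)
      qed
      then have "card (gdivisors r) \<le> 9"
        using card_gauss_units card_mono[OF finite_gauss_units] le_trans by blast
      moreover have "1 \<le> A ^ w r" using A1 by simp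
      ultimately show ?thesis using r by simp
    next
      case True
      obtain p where p: "p \<in> gauss_ints" "1 < cmod p" "gdvd p r"
        and irr: "\<And>u. u \<in> gauss_ints \<Longrightarrow> gdvd u p \<Longrightarrow> cmod u = 1 \<or> cmod u = cmod p"
        using gauss_irreducible_divisor[OF less.hyps True] by blast
      obtain k s where s: "s \<in> gauss_ints" "r = p ^ k * s" "\<not> gdvd p s"
        using gauss_multiplicity[OF less.hyps p(1,2) less.prems] by blast
      have k: "1 \<le> k" using s p(3) by (cases k) auto
      have nz: "s \<noteq> 0" "p ^ k \<noteq> 0" using less.prems s(2) by auto
      have "1 < cmod p ^ k" using p(2) k by (intro one_less_power) auto
      then have "cmod s < cmod r" using nz by (simp add: s(2) norm_mult norm_power)
      then have IH: "real (card (gdivisors s)) \<le> 9 * A ^ w s * cmod s powr \<epsilon>"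
        using less.IH s(1) nz by blast
      have sub: "{q \<in> S. gdvd q s} \<subseteq> {q \<in> S. gdvd q r}"
        using s(2) p(1) by (auto intro: gdvd_mult_left)
      \<comment> \<open>A small \<open>p\<close> divides \<open>r\<close> but not \<open>s\<close>,
        so \<open>w\<close> increases and pays for one factor \<open>A\<close>; a large
        \<open>p\<close> pays for itself, and \<open>w\<close> must merely not decrease.\<close>
      have step: "9 * (real k + 1) * A ^ w s \<le> (cmod p powr \<epsilon>) ^ k * A ^ w r"
      proof (cases "p \<in> S")
        case True
        then have "{q \<in> S. gdvd q s} \<subset> {q \<in> S. gdvd q r}" using sub p(3) s(3) by blast
        then have "w s < w r" unfolding w_def using finS by (intro psubset_card_mono) auto
        then have "A ^ Suc (w s) \<le> A ^ w r" using A1 by (intro power_increasing) auto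
        then have "(cmod p powr \<epsilon>) ^ k * (A * A ^ w s) \<le> (cmod p powr \<epsilon>) ^ k * A ^ w r"
          by (intro mult_left_mono) auto
        moreover have "9 * (real k + 1) * A ^ w s \<le> A * (cmod p powr \<epsilon>) ^ k * A ^ w s"
          using small[OF p(1,2)] A1 by (intro mult_right_mono) auto
        ultimately show ?thesis by (simp add: mult_ac)
      next
        case False
        have "w s \<le> w r" unfolding w_def using finS sub by (intro card_mono) auto
        then have "A ^ w s \<le> A ^ w r" using A1 by (intro power_increasing) auto
        then show ?thesis using large[OF p(1,2) False k] A1 by (intro mult_mono) auto
      qed
      have pw: "cmod r powr \<epsilon> = (cmod p powr \<epsilon>) ^ k * cmod s powr \<epsilon>"
      proof -
        have "0 < cmod p" using p(2) by linarith
        then have "(cmod p ^ k) powr \<epsilon> = (cmod p powr \<epsilon>) ^ k"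
          by (simp add: powr_realpow[symmetric] powr_powr mult.commute)
        then show ?thesis by (simp add: s(2) norm_mult norm_power powr_mult)
      qed
      have "card (gdivisors r) \<le> card (gdivisors (p ^ k)) * card (gdivisors s)"
        unfolding s(2) using p s nz by (intro card_gdivisors_mult) auto
      also have "\<dots> \<le> 9 * (k + 1) * card (gdivisors s)"
        using nz(2) p(2) by (intro mult_right_mono card_gdivisors_prime_power[OF p(1) _ irr]) auto
      finally have "real (card (gdivisors r)) \<le> real (9 * (k + 1) * card (gdivisors s))"
        by (rule of_nat_mono)
      also have "\<dots> = 9 * (real k + 1) * real (card (gdivisors s))" by simp
      also have "\<dots> \<le> 9 * (real k + 1) * (9 * A ^ w s * cmod s powr \<epsilon>)"
        using IH by (intro mult_left_mono) auto
      also have "\<dots> = 9 * (9 * (real k + 1) * A ^ w s) * cmod s powr \<epsilon>" by simp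
      also have "\<dots> \<le> 9 * ((cmod p powr \<epsilon>) ^ k * A ^ w r) * cmod s powr \<epsilon>"
        using step by (intro mult_right_mono mult_left_mono) auto
      also have "\<dots> = 9 * A ^ w r * cmod r powr \<epsilon>" by (simp add: pw)
      finally show ?thesis .
    qed
  qed
  show ?thesis
  proof (intro exI[of _ "9 * A ^ card S"] conjI ballI impI)
    show "0 < 9 * A ^ card S" using A1 by simp
    fix r assume r: "r \<in> gauss_ints" "r \<noteq> 0"
    have "A ^ w r \<le> A ^ card S" using A1 wS by (intro power_increasing) auto
    then have "9 * A ^ w r * cmod r powr \<epsilon> \<le> 9 * A ^ card S * cmod r powr \<epsilon>"
      by (intro mult_right_mono mult_left_mono) auto
    then show "real (card (gdivisors r)) \<le> 9 * A ^ card S * cmod r powr \<epsilon>"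
      using main[OF r] by linarith
  qed
qed

section \<open>Fractions with square denominator near a point\<close>

text \<open>With one point \<open>x\<close> of \<open>A\<close> fixed, y maps to (y - x) / l
  injectively into the Gaussian integers of modulus at most 2L / |l|, since the disc has diameter
  2L.\<close>

lemma card_congruent_in_ball:
  assumes "A \<subseteq> cball c L" "l \<noteq> 0" "0 \<le> L"
    and cong: "\<And>x y. x \<in> A \<Longrightarrow> y \<in> A \<Longrightarrow> (y - x) / l \<in> gauss_ints"
  shows "finite A" "real (card A) \<le> (4 * L / cmod l + 1)\<^sup>2"
proof -
  have "finite A \<and> real (card A) \<le> (4 * L / cmod l + 1)\<^sup>2"
  proof (cases "A = {}")
    case False
    then obtain x where x: "x \<in> A" by blast
    let ?f = "\<lambda>y. (y - x) / l"
    let ?B = "{k \<in> gauss_ints. cmod k \<le> 2 * L / cmod l}"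
    have inj: "inj_on ?f A" using assms(2) by (intro inj_onI) auto
    have "cmod (y - x) \<le> 2 * L" if "y \<in> A" for y
    proof -
      have "cmod (y - c) \<le> L" "cmod (x - c) \<le> L"
        using assms(1) that x by (auto simp: subset_iff dist_norm norm_minus_commute)
      moreover have "cmod (y - x) \<le> cmod (y - c) + cmod (x - c)"
        using norm_triangle_ineq4[of "y - c" "x - c"] by simp
      ultimately show ?thesis by linarith
    qed
    then have sub: "?f ` A \<subseteq> ?B" using cong[OF x]
      by (auto simp: norm_divide intro!: divide_right_mono)
    have "finite A" using inj sub finite_gauss_ball inj_on_finite by blast
    moreover have "card A \<le> card ?B" using inj sub finite_gauss_ball by (intro card_inj_on_le)
    moreover have "real (card ?B) \<le> (2 * (2 * L / cmod l) + 1)\<^sup>2"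
      using assms by (intro card_gauss_ball) auto
    ultimately show ?thesis by simp
  qed simp
  then show "finite A" "real (card A) \<le> (4 * L / cmod l + 1)\<^sup>2" by auto
qed

text \<open>One gcd is selected among its associates, so that it can serve as a function of the
  divisor over which sums are taken.\<close>

definition gauss_gcd :: "complex \<Rightarrow> complex \<Rightarrow> complex" where
  "gauss_gcd u v = (SOME g. g \<in> gauss_ints \<and> g \<noteq> 0 \<and> gdvd g u \<and> gdvd g v \<and>
     (\<exists>x\<in>gauss_ints. \<exists>y\<in>gauss_ints. g = x * u + y * v))"

lemma gauss_gcd:
  assumes "u \<in> gauss_ints" "v \<in> gauss_ints" "u \<noteq> 0"
  shows "gauss_gcd u v \<in> gauss_ints" "gauss_gcd u v \<noteq> 0" "gdvd (gauss_gcd u v) u" "gdvd (gauss_gcd u v) v"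
    "\<exists>x\<in>gauss_ints. \<exists>y\<in>gauss_ints. gauss_gcd u v = x * u + y * v"
proof -
  have "\<exists>g. g \<in> gauss_ints \<and> g \<noteq> 0 \<and> gdvd g u \<and> gdvd g v \<and>
     (\<exists>x\<in>gauss_ints. \<exists>y\<in>gauss_ints. g = x * u + y * v)"
    using gauss_bezout[OF assms(1,2)] assms(3) by metis
  from someI_ex[OF this, folded gauss_gcd_def] show
    "gauss_gcd u v \<in> gauss_ints" "gauss_gcd u v \<noteq> 0" "gdvd (gauss_gcd u v) u" "gdvd (gauss_gcd u v) v"
    "\<exists>x\<in>gauss_ints. \<exists>y\<in>gauss_ints. gauss_gcd u v = x * u + y * v" by blast+
qed

text \<open>In x (u d) + y (d v) both terms are multiples of u v. This is the divisibility of a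
  common multiple by the lcm u v / gcd(u, v), kept free of division.\<close>

lemma gdvd_mult_by_gcd:
  assumes "u \<in> gauss_ints" "v \<in> gauss_ints" "u \<noteq> 0" "gdvd u d" "gdvd v d"
  shows "gdvd (u * v) (gauss_gcd u v * d)"
proof -
  obtain x y where xy: "x \<in> gauss_ints" "y \<in> gauss_ints" "gauss_gcd u v = x * u + y * v"
    using gauss_gcd(5)[OF assms(1-3)] by blast
  have "gauss_gcd u v * d = x * (u * d) + y * (d * v)"
    unfolding xy(3) by (simp add: algebra_simps)
  moreover have "gdvd (u * v) (u * d)" "gdvd (u * v) (d * v)"
    using assms by (auto intro: gdvd_mult_mono)
  ultimately show ?thesis using xy by (auto intro: gdvd_add gdvd_mult_left)
qed

text \<open>Every root of \<open>q\<^sup>2 \<equiv> q\<^sub>1\<^sup>2 (mod r)\<close> satisfies \<open>q \<equiv> q\<^sub>1 (mod u)\<close>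
  and \<open>q \<equiv> -q\<^sub>1 (mod r/u)\<close> for some divisor \<open>u\<close> of \<open>r\<close>; this determines \<open>q\<close>
  modulo \<open>r / gcd(u, r/u)\<close>, and the gcd divides \<open>2 q\<^sub>1\<close>.\<close>

lemma card_square_roots_in_balls:
  assumes r: "r \<in> gauss_ints" "r \<noteq> 0" and q1: "q1 \<in> gauss_ints" and L: "0 \<le> L"
    and A: "\<And>q. q \<in> A \<Longrightarrow> q \<in> gauss_ints \<and> gdvd r ((q - q1) * (q + q1)) \<and>
              (cmod (q - q1) \<le> L \<or> cmod (q + q1) \<le> L)"
  shows "real (card A) \<le> (\<Sum>u\<in>gdivisors r. if gdvd (gauss_gcd u (r / u)) (2 * q1)
            then 2 * (4 * L * cmod (gauss_gcd u (r / u)) / cmod r + 1)\<^sup>2 else 0)"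
proof -
  \<comment> \<open>\<open>B u c\<close> collects the roots of sign pattern \<open>u\<close> in the
    disc about \<open>c\<close>. With c = q1 and c = -q1 these sets cover \<open>A\<close>, whence
    the factor 2 in the bound.\<close>
  define B where "B u c = {q \<in> A. gdvd u (q - q1) \<and> gdvd (r / u) (q + q1) \<and> cmod (q - c) \<le> L}" for u c
  let ?g = "\<lambda>u. gauss_gcd u (r / u)"
  have BB: "finite (B u c) \<and> real (card (B u c)) \<le>
      (if gdvd (?g u) (2 * q1) then (4 * L * cmod (?g u) / cmod r + 1)\<^sup>2 else 0)"
    if u: "u \<in> gdivisors r" for u c
  proof -
    note co = gdivisors_cofactor[OF u r(2)]
    note g = gauss_gcd[OF co(1,3,2)]
    have fin: "finite (B u c) \<and> real (card (B u c)) \<le> (4 * L / cmod (r / ?g u) + 1)\<^sup>2"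
    proof -
      have ball: "B u c \<subseteq> cball c L" by (auto simp: B_def dist_norm norm_minus_commute)
      have nz: "r / ?g u \<noteq> 0" using r g by simp
      have cong: "(y - x) / (r / ?g u) \<in> gauss_ints" if xy: "x \<in> B u c" "y \<in> B u c" for x y
      proof -
        have "gdvd u ((y - q1) - (x - q1))" "gdvd (r / u) ((y + q1) - (x + q1))"
          using xy unfolding B_def by (blast intro: gdvd_diff)+
        then have "gdvd (u * (r / u)) (?g u * (y - x))"
          by (intro gdvd_mult_by_gcd co) simp_all
        then have "gdvd r (?g u * (y - x))" using co(4) by simp
        then obtain k where "k \<in> gauss_ints" "?g u * (y - x) = r * k" unfolding gdvd_def by blast
        then show ?thesis using r by (simp add: mult.commute)
      qed
      show ?thesis using card_congruent_in_ball[OF ball nz L cong] by blast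
    qed
    show ?thesis
    proof (cases "B u c = {}")
      case False
      \<comment> \<open>A single member gives (q + q1) - (q - q1) = 2 q1 as a multiple of the gcd;
        an empty set accounts for the alternative 0.\<close>
      then obtain q where "gdvd u (q - q1)" "gdvd (r / u) (q + q1)" by (auto simp: B_def)
      then have "gdvd (?g u) ((q + q1) - (q - q1))"
        using g(3,4) gdvd_trans by (blast intro: gdvd_diff)
      then have "gdvd (?g u) (2 * q1)" by simp
      then show ?thesis using fin by (simp add: norm_divide)
    qed simp
  qed
  have finD: "finite (gdivisors r)" using r finite_gdivisors by blast
  have cover: "A \<subseteq> (\<Union>u\<in>gdivisors r. B u q1 \<union> B u (-q1))"
  proof
    fix q assume q: "q \<in> A"
    then have "q \<in> gauss_ints" "gdvd r ((q - q1) * (q + q1))" using A by auto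
    then obtain u v where uv: "u \<in> gauss_ints" "v \<in> gauss_ints" "r = u * v" "gdvd u (q - q1)" "gdvd v (q + q1)"
      using gdvd_mult_split[of r "q - q1" "q + q1"] r q1 by auto
    have "u \<noteq> 0" using uv r by auto
    then have "r / u = v" "u \<in> gdivisors r" using uv by (auto simp: gdivisors_def)
    then show "q \<in> (\<Union>u\<in>gdivisors r. B u q1 \<union> B u (-q1))"
      using uv q A[OF q] by (auto simp: B_def)
  qed
  have "card A \<le> card (\<Union>u\<in>gdivisors r. B u q1 \<union> B u (-q1))"
    using cover finD BB by (intro card_mono) auto
  also have "\<dots> \<le> (\<Sum>u\<in>gdivisors r. card (B u q1 \<union> B u (-q1)))"
    using finD by (rule card_UN_le)
  also have "\<dots> \<le> (\<Sum>u\<in>gdivisors r. card (B u q1) + card (B u (-q1)))"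
    by (intro sum_mono card_Un_le)
  finally have "real (card A) \<le> real (\<Sum>u\<in>gdivisors r. card (B u q1) + card (B u (-q1)))"
    by (rule of_nat_mono)
  also have "\<dots> = (\<Sum>u\<in>gdivisors r. real (card (B u q1)) + real (card (B u (-q1))))" by simp
  also have "\<dots> \<le> (\<Sum>u\<in>gdivisors r. if gdvd (?g u) (2 * q1)
            then 2 * (4 * L * cmod (?g u) / cmod r + 1)\<^sup>2 else 0)"
    using BB by (intro sum_mono) (smt (verit))
  finally show ?thesis .
qed

text \<open>The numerator is any Gaussian integer and not a chosen residue, so nearness modulo Z[i]
  becomes plain distance in the plane. Pairs are counted rather than fractions because the sieve sum
  is indexed by pairs.\<close>

definition square_fractions :: "real \<Rightarrow> real \<Rightarrow> complex \<Rightarrow> (complex \<times> complex) set" where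
  "square_fractions Q \<rho> \<alpha> = {(q, a). q \<in> gauss_ints \<and> a \<in> gauss_ints \<and> q \<noteq> 0 \<and> gnorm q \<le> Q \<and>
     gcoprime a q \<and> cmod (a / q\<^sup>2 - \<alpha>) \<le> \<rho>}"

lemma finite_square_fractions: "finite (square_fractions Q \<rho> \<alpha>)"
proof (rule finite_subset)
  let ?B1 = "{q \<in> gauss_ints. cmod q \<le> sqrt Q}"
  let ?B2 = "{a \<in> gauss_ints. cmod a \<le> (\<rho> + cmod \<alpha>) * Q}"
  show "square_fractions Q \<rho> \<alpha> \<subseteq> ?B1 \<times> ?B2"
  proof (clarsimp simp: square_fractions_def)
    fix q a assume q: "q \<noteq> 0" "gnorm q \<le> Q" and a: "cmod (a / q\<^sup>2 - \<alpha>) \<le> \<rho>"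
    have "cmod (a / q\<^sup>2) \<le> \<rho> + cmod \<alpha>" using a norm_triangle_ineq2[of "a / q\<^sup>2" \<alpha>] by linarith
    moreover from this have "0 \<le> \<rho> + cmod \<alpha>" using norm_ge_zero order_trans by blast
    ultimately have "cmod a \<le> (\<rho> + cmod \<alpha>) * (cmod q)\<^sup>2" and "0 \<le> \<rho> + cmod \<alpha>"
      using q by (simp_all add: norm_divide norm_power field_simps)
    then show "cmod q \<le> sqrt Q \<and> cmod a \<le> (\<rho> + cmod \<alpha>) * Q"
      using q by (auto simp: gnorm_eq_cmod intro: real_le_rsqrt order_trans[OF _ mult_left_mono])
  qed
  show "finite (?B1 \<times> ?B2)" by (intro finite_cartesian_product finite_gauss_ball)
qed

lemma card_square_roots_complex: "finite {q::complex. q\<^sup>2 = c}" "card {q::complex. q\<^sup>2 = c} \<le> 2"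
proof -
  have sub: "{q::complex. q\<^sup>2 = c} \<subseteq> {csqrt c, - csqrt c}"
    by (smt (verit) insertCI mem_Collect_eq power2_csqrt power2_eq_iff subsetI)
  then show "finite {q::complex. q\<^sup>2 = c}" using finite_subset by blast
  show "card {q::complex. q\<^sup>2 = c} \<le> 2"
    using card_mono[OF _ sub] card_insert_le_m1[of 2 "{- csqrt c}" "csqrt c"] by simp
qed

text \<open>Here a / q^2 = b / r with both sides in lowest terms, so q^2 is a unit times
  \<open>r\<close>. At most 9 units and 2 roots for each give 18; \<open>a\<close> is determined by
  \<open>q\<close>.\<close>

lemma card_square_fractions_eq:
  assumes "r \<in> gauss_ints" "b \<in> gauss_ints" "r \<noteq> 0"
    and bez: "x \<in> gauss_ints" "y \<in> gauss_ints" "1 = x * b + y * r"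
  shows "card {(q, a) \<in> square_fractions Q \<rho> \<alpha>. a * r - b * q\<^sup>2 = 0} \<le> 18"
proof -
  let ?F = "{(q, a) \<in> square_fractions Q \<rho> \<alpha>. a * r - b * q\<^sup>2 = 0}"
  let ?S = "\<Union>e\<in>gauss_units. {q. q\<^sup>2 = r * e}"
  have inj: "inj_on fst ?F"
  proof (rule inj_onI, clarsimp)
    fix q a a' assume "a * r = b * q\<^sup>2" "a' * r = b * q\<^sup>2"
    then show "a = a'" using assms(3) by (metis mult_right_cancel)
  qed
  have sub: "fst ` ?F \<subseteq> ?S"
  proof clarsimp
    fix q a assume "(q, a) \<in> square_fractions Q \<rho> \<alpha>" and eq: "a * r = b * q\<^sup>2"
    then have q: "q \<in> gauss_ints" "a \<in> gauss_ints" "q \<noteq> 0" "gcoprime a q"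
      by (auto simp: square_fractions_def)
    obtain x' y' where xy: "x' \<in> gauss_ints" "y' \<in> gauss_ints" "1 = x' * a + y' * q"
      using gcoprime_bezout[OF q(2,1,4,3)] .
    \<comment> \<open>Squaring the identity makes \<open>a\<close> coprime to q^2, not only to
      \<open>q\<close>.\<close>
    have "1 = (x' * a + y' * q)\<^sup>2" using xy(3) by simp
    also have "\<dots> = (x' * (x' * a + 2 * y' * q)) * a + y'\<^sup>2 * q\<^sup>2"
      by (simp add: power2_eq_square algebra_simps)
    finally have bez2: "1 = (x' * (x' * a + 2 * y' * q)) * a + y'\<^sup>2 * q\<^sup>2" .
    have qr: "gdvd (q\<^sup>2) (a * r)" unfolding eq by (rule gdvd_mult_left[OF gdvd_refl assms(2)])
    have d1: "gdvd (q\<^sup>2) r"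
      by (rule gdvd_cancel_coprime[OF bez2 _ _ _ qr]) (use q xy(1,2) assms(1) in simp_all)
    have rq: "gdvd r (b * q\<^sup>2)" unfolding eq[symmetric] by (rule gdvd_mult_left[OF gdvd_refl q(2)])
    have d2: "gdvd r (q\<^sup>2)"
      by (rule gdvd_cancel_coprime[OF bez(3) _ _ _ rq]) (use q bez(1,2) in simp_all)
    obtain e where e: "e \<in> gauss_ints" "q\<^sup>2 = r * e" using d2 by (auto simp: gdvd_def)
    have "cmod (q\<^sup>2) = cmod r"
      using gdvd_imp_cmod_le[OF d1 assms(3)] gdvd_imp_cmod_le[OF d2] q(3) by simp
    then have "cmod e = 1" using e(2) assms(3) by (simp add: norm_mult)
    then show "\<exists>e\<in>gauss_units. q\<^sup>2 = r * e" using e by (auto simp: gauss_units_def)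
  qed
  have "card ?F = card (fst ` ?F)" using inj by (simp add: card_image)
  also have "\<dots> \<le> card ?S"
    using sub finite_gauss_units card_square_roots_complex(1) by (intro card_mono) auto
  also have "\<dots> \<le> (\<Sum>e\<in>gauss_units. card {q. q\<^sup>2 = r * e})"
    using finite_gauss_units by (rule card_UN_le)
  also have "\<dots> \<le> (\<Sum>e\<in>gauss_units. 2)" by (intro sum_mono card_square_roots_complex)
  also have "\<dots> \<le> 18" using card_gauss_units by simp
  finally show ?thesis .
qed

text \<open>With \<open>m = a r - b q\<^sup>2\<close>, fractions \<open>a / q\<^sup>2\<close> near \<open>\<alpha>\<close> correspond to
  solutions of \<open>b q\<^sup>2 \<equiv> -m (mod r)\<close> with \<open>|m| \<le> X\<close>. For fixed \<open>m \<noteq> 0\<close> all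
  solutions lie within \<open>L\<close> of \<open>\<plusminus>q\<^sub>1\<close>, where \<open>q\<^sub>1\<close> is the one of largest modulus. If
  \<open>g = gcd(u, r/u)\<close> divides \<open>2 q\<^sub>1\<close> then \<open>g\<^sup>2\<close> divides \<open>4 m\<close>, and the scarcity
  of such \<open>m\<close> compensates for the loss of \<open>g\<close> in the modulus \<open>r / g\<close>.\<close>

lemma card_square_fractions_neq:
  assumes r: "r \<in> gauss_ints" "r \<noteq> 0" and b: "b \<in> gauss_ints"
    and bez: "x \<in> gauss_ints" "y \<in> gauss_ints" "1 = x * b + y * r"
    and \<rho>: "0 < \<rho>" and Q: "0 \<le> Q" and \<tau>: "\<tau> = max \<rho> (cmod (\<alpha> - b / r))"
  shows "real (card {(q, a) \<in> square_fractions Q \<rho> \<alpha>. a * r - b * q\<^sup>2 \<noteq> 0})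
    \<le> 147456 * real (card (gdivisors r)) * ((cmod r)\<^sup>2 * Q\<^sup>2 * \<tau>\<^sup>2 + Q ^ 3 * \<rho>\<^sup>2)"
proof -
  let ?F = "{(q, a) \<in> square_fractions Q \<rho> \<alpha>. a * r - b * q\<^sup>2 \<noteq> 0}"
  let ?g = "\<lambda>u. gauss_gcd u (r / u)"
  \<comment> \<open>m = r q^2 (a / q^2 - \<alpha>) + r q^2 z, and each term is at most |r| Q \<tau>
    in modulus.\<close>
  define X where "X = 2 * cmod r * Q * \<tau>"
  \<comment> \<open>Two solutions for one \<open>m\<close> satisfy |z| |q - q1| |q + q1| <= 2 |q1|^2
    \<rho>, and one of the two factors is at least |q1|; if z is nonzero, the other is at most 2
    sqrt Q \<rho> / |z|. For \<tau> = \<rho> the value is 2 sqrt Q, which excludes nothing.\<close>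
  define L where "L = 2 * sqrt Q * \<rho> / \<tau>"
  define z where "z = \<alpha> - b / r"
  define Ms where "Ms = {m \<in> gauss_ints. m \<noteq> 0 \<and> cmod m \<le> X}"
  define A where "A m = {q. \<exists>a. (q, a) \<in> square_fractions Q \<rho> \<alpha> \<and> a * r - b * q\<^sup>2 = m}" for m
  define N where "N u = 2 * (4 * L * cmod (?g u) / cmod r + 1)\<^sup>2" for u
  have \<tau>0: "0 < \<tau>" "\<rho> \<le> \<tau>" "cmod z \<le> \<tau>" using \<rho> by (auto simp: \<tau> z_def)
  have X0: "0 \<le> X" using Q \<tau>0 by (simp add: X_def)
  have L0: "0 \<le> L" using Q \<tau>0 \<rho> by (simp add: L_def)
  have N0: "0 \<le> N u" for u by (simp add: N_def)
  have finMs: "finite Ms"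
    unfolding Ms_def by (rule finite_subset[OF _ finite_gauss_ball[of X]]) auto
  have finD: "finite (gdivisors r)" using r finite_gdivisors by blast
  have finA: "finite (A m)" for m
    by (rule finite_subset[OF _ finite_imageI[OF finite_square_fractions[of Q \<rho> \<alpha>], of fst]])
       (force simp: A_def)
  have close: "cmod (m - r * q\<^sup>2 * z) \<le> cmod r * (cmod q)\<^sup>2 * \<rho>"
    if "(q, a) \<in> square_fractions Q \<rho> \<alpha>" "a * r - b * q\<^sup>2 = m" for q a m
  proof -
    have q: "q \<noteq> 0" "cmod (a / q\<^sup>2 - \<alpha>) \<le> \<rho>" using that by (auto simp: square_fractions_def)
    have "m - r * q\<^sup>2 * z = r * q\<^sup>2 * (a / q\<^sup>2 - \<alpha>)"
      unfolding that(2)[symmetric] z_def using q(1) r(2) by (simp add: field_simps)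
    then have "cmod (m - r * q\<^sup>2 * z) = cmod r * (cmod q)\<^sup>2 * cmod (a / q\<^sup>2 - \<alpha>)"
      by (simp add: norm_mult norm_power)
    also have "\<dots> \<le> cmod r * (cmod q)\<^sup>2 * \<rho>" using q(2) by (intro mult_left_mono) auto
    finally show ?thesis .
  qed
  have mX: "cmod m \<le> X" if "(q, a) \<in> square_fractions Q \<rho> \<alpha>" "a * r - b * q\<^sup>2 = m" for q a m
  proof -
    have q: "(cmod q)\<^sup>2 \<le> Q" using that by (auto simp: square_fractions_def gnorm_eq_cmod)
    have "cmod m \<le> cmod (m - r * q\<^sup>2 * z) + cmod (r * q\<^sup>2 * z)"
      using norm_triangle_ineq[of "m - r * q\<^sup>2 * z" "r * q\<^sup>2 * z"] by simp
    also have "\<dots> \<le> cmod r * (cmod q)\<^sup>2 * \<rho> + cmod r * (cmod q)\<^sup>2 * cmod z"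
      using close[OF that] by (simp add: norm_mult norm_power)
    also have "\<dots> \<le> cmod r * Q * \<tau> + cmod r * Q * \<tau>"
      using q \<tau>0 Q \<rho> by (intro add_mono mult_mono mult_left_mono) auto
    finally show ?thesis by (simp add: X_def mult_ac)
  qed
  have "inj_on (\<lambda>(q, a). (a * r - b * q\<^sup>2, q)) ?F"
    using r by (auto intro!: inj_onI)
  moreover have "(\<lambda>(q, a). (a * r - b * q\<^sup>2, q)) ` ?F \<subseteq> Sigma Ms A"
    using mX r b by (fastforce simp: A_def Ms_def square_fractions_def)
  moreover have finSig: "finite (Sigma Ms A)" using finMs finA by (intro finite_SigmaI) auto
  ultimately have "card ?F \<le> card (Sigma Ms A)" by (intro card_inj_on_le)
  also have "\<dots> = (\<Sum>m\<in>Ms. card (A m))" using finMs finA by (intro card_SigmaI) auto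
  finally have "real (card ?F) \<le> real (\<Sum>m\<in>Ms. card (A m))" by (rule of_nat_mono)
  also have "\<dots> = (\<Sum>m\<in>Ms. real (card (A m)))" by simp
  also have "\<dots> \<le> (\<Sum>m\<in>Ms. \<Sum>u\<in>gdivisors r. if gdvd ((?g u)\<^sup>2) (4 * m) then N u else 0)"
  proof (rule sum_mono)
    fix m assume "m \<in> Ms"
    show "real (card (A m)) \<le> (\<Sum>u\<in>gdivisors r. if gdvd ((?g u)\<^sup>2) (4 * m) then N u else 0)"
    proof (cases "A m = {}")
      case True
      then show ?thesis using N0 by (auto intro!: sum_nonneg)
    next
      case False
      obtain q1 where q1: "q1 \<in> A m" and max: "\<And>q. q \<in> A m \<Longrightarrow> cmod q \<le> cmod q1"
      proof -
        have ne: "finite (cmod ` A m)" "cmod ` A m \<noteq> {}" using finA False by auto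
        obtain q1 where "q1 \<in> A m" "cmod q1 = Max (cmod ` A m)" using Max_in[OF ne] by force
        then show ?thesis using that Max_ge[OF ne(1)] by simp
      qed
      obtain a1 where a1: "(q1, a1) \<in> square_fractions Q \<rho> \<alpha>" "a1 * r - b * q1\<^sup>2 = m"
        using q1 by (auto simp: A_def)
      have q1G: "q1 \<in> gauss_ints" "a1 \<in> gauss_ints" "q1 \<noteq> 0" "(cmod q1)\<^sup>2 \<le> Q"
        using a1 by (auto simp: square_fractions_def gnorm_eq_cmod)
      have q1Q: "cmod q1 \<le> sqrt Q" using q1G(4) by (rule real_le_rsqrt)
      have "real (card (A m)) \<le> (\<Sum>u\<in>gdivisors r. if gdvd (?g u) (2 * q1) then N u else 0)"
        unfolding N_def
      proof (rule card_square_roots_in_balls[OF r q1G(1) L0])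
        fix q assume q: "q \<in> A m"
        then obtain a where a: "(q, a) \<in> square_fractions Q \<rho> \<alpha>" "a * r - b * q\<^sup>2 = m"
          by (auto simp: A_def)
        have qG: "q \<in> gauss_ints" "a \<in> gauss_ints"
          using a by (auto simp: square_fractions_def)
        have qq: "q\<^sup>2 - q1\<^sup>2 = (q - q1) * (q + q1)" by (simp add: power2_eq_square algebra_simps)
        have "b * ((q - q1) * (q + q1)) = r * (a - a1)"
          unfolding qq[symmetric] using a(2) a1(2) by (simp add: algebra_simps)
        then have bd: "gdvd r (b * ((q - q1) * (q + q1)))" using qG q1G by simp
        have dv: "gdvd r ((q - q1) * (q + q1))"
          by (rule gdvd_cancel_coprime[OF bez(3) _ _ _ bd]) (use qG q1G bez(1,2) in simp_all)
        have le: "cmod q \<le> cmod q1" using max q .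
        have "cmod (q - q1) \<le> L \<or> cmod (q + q1) \<le> L"
        proof (cases "cmod z \<le> \<rho>")
          case True
          then have "L = 2 * sqrt Q" using \<rho> by (simp add: L_def \<tau> z_def)
          then show ?thesis using norm_triangle_ineq4[of q q1] le q1Q by linarith
        next
          case False
          then have z: "\<tau> = cmod z" "0 < cmod z" using \<rho> by (auto simp: \<tau> z_def)
          have "cmod r * (cmod z * (cmod (q - q1) * cmod (q + q1))) = cmod (r * z * (q\<^sup>2 - q1\<^sup>2))"
            by (simp add: qq norm_mult)
          also have "r * z * (q\<^sup>2 - q1\<^sup>2) = (m - r * q1\<^sup>2 * z) - (m - r * q\<^sup>2 * z)"
            by (simp add: algebra_simps)
          also have "cmod \<dots> \<le> cmod r * (cmod q1)\<^sup>2 * \<rho> + cmod r * (cmod q)\<^sup>2 * \<rho>"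
            using close[OF a1] close[OF a] norm_triangle_ineq4 by (smt (verit))
          also have "\<dots> \<le> cmod r * (cmod q1)\<^sup>2 * \<rho> + cmod r * (cmod q1)\<^sup>2 * \<rho>"
            using le \<rho> by (intro add_mono mult_right_mono mult_left_mono power_mono) auto
          also have "\<dots> = cmod r * (2 * (cmod q1)\<^sup>2 * \<rho>)" by simp
          finally have "cmod z * (cmod (q - q1) * cmod (q + q1)) \<le> 2 * (cmod q1)\<^sup>2 * \<rho>"
            using r by simp
          then have prod: "cmod (q - q1) * cmod (q + q1) \<le> cmod q1 * (2 * cmod q1 * \<rho> / cmod z)"
            using z by (simp add: field_simps power2_eq_square)
          \<comment> \<open>q1 is half the difference of q + q1 and q - q1, so the larger of these
            has modulus at least |q1|.\<close>
          have "2 * cmod q1 \<le> cmod (q - q1) + cmod (q + q1)"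
            using norm_triangle_ineq4[of "q + q1" "q - q1"] by (simp flip: mult_2 add: norm_mult)
          then consider "cmod q1 \<le> cmod (q - q1)" | "cmod q1 \<le> cmod (q + q1)" by linarith
          then have "cmod (q - q1) \<le> 2 * cmod q1 * \<rho> / cmod z \<or> cmod (q + q1) \<le> 2 * cmod q1 * \<rho> / cmod z"
          proof cases
            case 1
            then have "cmod q1 * cmod (q + q1) \<le> cmod (q - q1) * cmod (q + q1)" by (rule mult_right_mono) simp
            then have "cmod q1 * cmod (q + q1) \<le> cmod q1 * (2 * cmod q1 * \<rho> / cmod z)" using prod by linarith
            then show ?thesis using q1G(3) by (subst (asm) mult_le_cancel_left_pos) simp_all
          next
            case 2
            then have "cmod q1 * cmod (q - q1) \<le> cmod (q + q1) * cmod (q - q1)" by (rule mult_right_mono) simp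
            then have "cmod q1 * cmod (q - q1) \<le> cmod q1 * (2 * cmod q1 * \<rho> / cmod z)"
              using prod by (simp add: mult.commute)
            then show ?thesis using q1G(3) by (subst (asm) mult_le_cancel_left_pos) simp_all
          qed
          moreover have "2 * cmod q1 * \<rho> / cmod z \<le> L"
            unfolding L_def z(1) using q1Q \<rho> z(2) by (intro divide_right_mono mult_right_mono) auto
          ultimately show ?thesis by linarith
        qed
        then show "q \<in> gauss_ints \<and> gdvd r ((q - q1) * (q + q1)) \<and>
              (cmod (q - q1) \<le> L \<or> cmod (q + q1) \<le> L)" using qG dv by blast
      qed
      also have "\<dots> \<le> (\<Sum>u\<in>gdivisors r. if gdvd ((?g u)\<^sup>2) (4 * m) then N u else 0)"
      proof (rule sum_mono)
        fix u assume u: "u \<in> gdivisors r"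
        note co = gdivisors_cofactor[OF u r(2)]
        note g = gauss_gcd[OF co(1,3,2)]
        \<comment> \<open>g divides both \<open>u\<close> and r / u, so g^2 divides
          \<open>r\<close>; it also divides (2 q1)^2, hence 4m = 4 a1 r - b (2 q1)^2.\<close>
        have "gdvd ((?g u)\<^sup>2) (4 * m)" if "gdvd (?g u) (2 * q1)"
        proof -
          have "gdvd (?g u * ?g u) (u * (r / u))" using g by (intro gdvd_mult_mono)
          then have "gdvd ((?g u)\<^sup>2) r" using co(4) by (simp add: power2_eq_square)
          then have 1: "gdvd ((?g u)\<^sup>2) (r * (2 * (2 * a1)))" using q1G by (intro gdvd_mult_right gauss_ints_mult gauss_ints_2) auto
          have "gdvd (?g u * ?g u) ((2 * q1) * (2 * q1))" using that that by (rule gdvd_mult_mono)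
          then have 2: "gdvd ((?g u)\<^sup>2) (b * ((2 * q1) * (2 * q1)))"
            unfolding power2_eq_square using b by (rule gdvd_mult_left)
          have "4 * m = r * (2 * (2 * a1)) - b * ((2 * q1) * (2 * q1))"
            unfolding a1(2)[symmetric] by (simp add: power2_eq_square algebra_simps)
          then show ?thesis using gdvd_diff[OF 1 2] by simp
        qed
        then show "(if gdvd (?g u) (2 * q1) then N u else 0)
            \<le> (if gdvd ((?g u)\<^sup>2) (4 * m) then N u else 0)" using N0 by auto
      qed
      finally show ?thesis .
    qed
  qed
  also have "\<dots> = (\<Sum>u\<in>gdivisors r. \<Sum>m\<in>Ms. if gdvd ((?g u)\<^sup>2) (4 * m) then N u else 0)"
    by (rule sum.swap)
  also have "\<dots> = (\<Sum>u\<in>gdivisors r. real (card {m \<in> Ms. gdvd ((?g u)\<^sup>2) (4 * m)}) * N u)"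
    using finMs by (simp add: sum.If_cases Int_def)
  also have "\<dots> \<le> (\<Sum>u\<in>gdivisors r. 147456 * ((cmod r)\<^sup>2 * Q\<^sup>2 * \<tau>\<^sup>2 + Q ^ 3 * \<rho>\<^sup>2))"
  proof (rule sum_mono)
    fix u assume u: "u \<in> gdivisors r"
    note co = gdivisors_cofactor[OF u r(2)]
    note g = gauss_gcd[OF co(1,3,2)]
    let ?c = "real (card {m \<in> Ms. gdvd ((?g u)\<^sup>2) (4 * m)})"
    define \<gamma> where "\<gamma> = cmod (?g u)"
    have \<gamma>1: "1 \<le> \<gamma>" unfolding \<gamma>_def using g by (intro cmod_gauss_ge_1)
    \<comment> \<open>Two counts of the same \<open>m\<close>: this one ignores the divisibility and
      serves the constant part of \<open>N u\<close>, the next one uses it and serves the part with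
      v^2.\<close>
    have c1: "?c \<le> 9 * X\<^sup>2"
    proof -
      have "card {m \<in> Ms. gdvd ((?g u)\<^sup>2) (4 * m)} \<le> card Ms" using finMs by (intro card_mono) auto
      then show ?thesis using card_gauss_ball_nonzero[OF X0] unfolding Ms_def by linarith
    qed
    have c2: "?c \<le> 9 * (4 * X / \<gamma>\<^sup>2)\<^sup>2"
    proof -
      let ?B = "{k \<in> gauss_ints. k \<noteq> 0 \<and> cmod k \<le> 4 * X / \<gamma>\<^sup>2}"
      have "inj_on (\<lambda>m. 4 * m / (?g u)\<^sup>2) {m \<in> Ms. gdvd ((?g u)\<^sup>2) (4 * m)}"
        using g(2) by (intro inj_onI) auto
      moreover have "(\<lambda>m. 4 * m / (?g u)\<^sup>2) ` {m \<in> Ms. gdvd ((?g u)\<^sup>2) (4 * m)} \<subseteq> ?B"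
      proof clarify
        fix m assume m: "m \<in> Ms" "gdvd ((?g u)\<^sup>2) (4 * m)"
        then obtain k where "k \<in> gauss_ints" "4 * m = (?g u)\<^sup>2 * k" by (auto simp: gdvd_def)
        then have "4 * m / (?g u)\<^sup>2 \<in> gauss_ints" using g(2) by simp
        then show "4 * m / (?g u)\<^sup>2 \<in> gauss_ints \<and> 4 * m / (?g u)\<^sup>2 \<noteq> 0 \<and> cmod (4 * m / (?g u)\<^sup>2) \<le> 4 * X / \<gamma>\<^sup>2"
          using m(1) g(2) by (auto simp: Ms_def \<gamma>_def norm_divide norm_mult norm_power intro!: divide_right_mono)
      qed
      moreover have "finite ?B"
        by (rule finite_subset[OF _ finite_gauss_ball[of "4 * X / \<gamma>\<^sup>2"]]) auto
      ultimately have "card {m \<in> Ms. gdvd ((?g u)\<^sup>2) (4 * m)} \<le> card ?B" by (intro card_inj_on_le)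
      moreover have "real (card ?B) \<le> 9 * (4 * X / \<gamma>\<^sup>2)\<^sup>2"
        using X0 by (intro card_gauss_ball_nonzero) simp
      ultimately show ?thesis by linarith
    qed
    define v where "v = 4 * L * \<gamma> / cmod r"
    have N: "N u \<le> 4 * v\<^sup>2 + 4"
    proof -
      have "N u = 2 * (v + 1)\<^sup>2" by (simp add: N_def v_def \<gamma>_def)
      moreover have "0 \<le> (v - 1)\<^sup>2" by simp
      ultimately show ?thesis by (simp add: power2_eq_square algebra_simps)
    qed
    have v2: "?c * v\<^sup>2 \<le> 2304 * (X * L / cmod r)\<^sup>2"
    proof -
      have "?c * v\<^sup>2 \<le> 9 * (4 * X / \<gamma>\<^sup>2)\<^sup>2 * v\<^sup>2" using c2 by (intro mult_right_mono) auto
      also have "\<dots> = 9 * (4 * X / \<gamma>\<^sup>2 * v)\<^sup>2" by (simp only: power_mult_distrib mult.assoc)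
      also have "4 * X / \<gamma>\<^sup>2 * v = 16 * (X * L / cmod r) / \<gamma>"
        using \<gamma>1 by (simp add: v_def power2_eq_square)
      also have "9 * (16 * (X * L / cmod r) / \<gamma>)\<^sup>2 = 2304 * (X * L / cmod r)\<^sup>2 / \<gamma>\<^sup>2"
        by (simp add: power_mult_distrib power_divide)
      also have "\<dots> \<le> 2304 * (X * L / cmod r)\<^sup>2"
        using \<gamma>1 by (simp add: divide_le_eq mult_le_cancel_left1)
      finally show ?thesis .
    qed
    have "X * L / cmod r = 4 * Q * sqrt Q * \<rho>" using r \<tau>0 by (simp add: X_def L_def)
    then have XL: "(X * L / cmod r)\<^sup>2 = 16 * (Q ^ 3 * \<rho>\<^sup>2)"
      using Q by (simp add: power_mult_distrib power2_eq_square[of Q] power3_eq_cube)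
    have X2: "X\<^sup>2 = 4 * ((cmod r)\<^sup>2 * Q\<^sup>2 * \<tau>\<^sup>2)" by (simp add: X_def power_mult_distrib)
    have "?c * N u \<le> ?c * (4 * v\<^sup>2 + 4)" using N by (intro mult_left_mono) auto
    also have "\<dots> = 4 * (?c * v\<^sup>2) + 4 * ?c" by (simp add: algebra_simps)
    also have "\<dots> \<le> 4 * (2304 * (16 * (Q ^ 3 * \<rho>\<^sup>2))) + 4 * (9 * (4 * ((cmod r)\<^sup>2 * Q\<^sup>2 * \<tau>\<^sup>2)))"
      using v2 c1 unfolding XL X2 by linarith
    \<comment> \<open>147456 = 4 * 2304 * 16 comes from the disc part; the other coefficient is only
      4 * 9 * 4 = 144.\<close>
    also have "\<dots> \<le> 147456 * ((cmod r)\<^sup>2 * Q\<^sup>2 * \<tau>\<^sup>2 + Q ^ 3 * \<rho>\<^sup>2)"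
      using mult_nonneg_nonneg[of "(cmod r)\<^sup>2 * Q\<^sup>2" "\<tau>\<^sup>2"] by (simp add: algebra_simps)
    finally show "?c * N u \<le> 147456 * ((cmod r)\<^sup>2 * Q\<^sup>2 * \<tau>\<^sup>2 + Q ^ 3 * \<rho>\<^sup>2)" .
  qed
  also have "\<dots> = 147456 * real (card (gdivisors r)) * ((cmod r)\<^sup>2 * Q\<^sup>2 * \<tau>\<^sup>2 + Q ^ 3 * \<rho>\<^sup>2)"
    by simp
  finally show ?thesis .
qed

text \<open>Pigeonhole: the (t + 1)^2 multipliers with coordinates in 0..t fall into t^2 cells
  according to the fractional parts of their products with \<alpha>. The factors 2 come from the two
  coordinates. Dividing numerator and denominator by their gcd makes them coprime and only improves
  both estimates.\<close>

lemma gauss_dirichlet: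
  assumes t: "1 \<le> (t::nat)"
  obtains r b x y where "r \<in> gauss_ints" "b \<in> gauss_ints" "r \<noteq> 0"
    "x \<in> gauss_ints" "y \<in> gauss_ints" "1 = x * b + y * r"
    "(cmod r)\<^sup>2 \<le> 2 * (real t)\<^sup>2" "(cmod (r * \<alpha> - b))\<^sup>2 \<le> 2 / (real t)\<^sup>2"
proof -
  define \<iota> where "\<iota> p = Complex (of_int (fst p)) (of_int (snd p))" for p :: "int \<times> int"
  define cell where "cell p = (\<lfloor>t * frac (Re (\<iota> p * \<alpha>))\<rfloor>, \<lfloor>t * frac (Im (\<iota> p * \<alpha>))\<rfloor>)" for p
  let ?J = "{0..int t} \<times> {0..int t}"
  have fr: "\<lfloor>t * frac x\<rfloor> \<in> {0..<int t}" for x :: real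
  proof -
    have "t * frac x < real t * 1" using t frac_lt_1[of x] by (intro mult_strict_left_mono) auto
    then show ?thesis by (simp add: floor_less_iff)
  qed
  have "cell ` ?J \<subseteq> {0..<int t} \<times> {0..<int t}" using fr by (auto simp: cell_def)
  then have "card (cell ` ?J) \<le> card ({0..<int t} \<times> {0..<int t})" by (intro card_mono) auto
  also have "\<dots> < card ?J" by (simp add: card_cartesian_product mult_strict_mono)
  finally have "\<not> inj_on cell ?J" by (rule pigeonhole)
  then obtain p p' where p: "p \<in> ?J" "p' \<in> ?J" "p \<noteq> p'" "cell p = cell p'"
    unfolding inj_on_def by blast
  define r0 where "r0 = \<iota> p - \<iota> p'"
  define b0 where "b0 = Complex (of_int (\<lfloor>Re (\<iota> p * \<alpha>)\<rfloor> - \<lfloor>Re (\<iota> p' * \<alpha>)\<rfloor>)) (of_int (\<lfloor>Im (\<iota> p * \<alpha>)\<rfloor> - \<lfloor>Im (\<iota> p' * \<alpha>)\<rfloor>))"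
  have G: "r0 \<in> gauss_ints" "b0 \<in> gauss_ints"
    by (auto simp: r0_def b0_def \<iota>_def gauss_ints_def)
  have r0: "r0 \<noteq> 0" using p(3) by (auto simp: r0_def \<iota>_def complex_eq_iff prod_eq_iff)
  have "(Re r0)\<^sup>2 \<le> (real t)\<^sup>2" "(Im r0)\<^sup>2 \<le> (real t)\<^sup>2"
    using p(1,2) by (auto simp: r0_def \<iota>_def abs_le_square_iff[symmetric])
  then have r0_le: "(cmod r0)\<^sup>2 \<le> 2 * (real t)\<^sup>2" by (simp add: cmod_power2)
  have sq: "(v - w)\<^sup>2 \<le> (1 / real t)\<^sup>2" if "\<lfloor>t * v\<rfloor> = \<lfloor>t * w\<rfloor>" for v w :: real
  proof -
    have "\<bar>t * v - t * w\<bar> < 1" using that by linarith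
    then have "t * \<bar>v - w\<bar> < 1" by (simp add: right_diff_distrib[symmetric] abs_mult)
    then have "\<bar>v - w\<bar> \<le> 1 / t" using t by (simp add: field_simps)
    then show ?thesis using t by (simp add: abs_le_square_iff[symmetric])
  qed
  have "Re (r0 * \<alpha> - b0) = frac (Re (\<iota> p * \<alpha>)) - frac (Re (\<iota> p' * \<alpha>))"
       "Im (r0 * \<alpha> - b0) = frac (Im (\<iota> p * \<alpha>)) - frac (Im (\<iota> p' * \<alpha>))"
    by (simp_all add: r0_def b0_def frac_def algebra_simps)
  moreover have "\<lfloor>t * frac (Re (\<iota> p * \<alpha>))\<rfloor> = \<lfloor>t * frac (Re (\<iota> p' * \<alpha>))\<rfloor>"
       "\<lfloor>t * frac (Im (\<iota> p * \<alpha>))\<rfloor> = \<lfloor>t * frac (Im (\<iota> p' * \<alpha>))\<rfloor>"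
    using p(4) by (simp_all add: cell_def)
  ultimately have "(Re (r0 * \<alpha> - b0))\<^sup>2 \<le> (1 / real t)\<^sup>2" "(Im (r0 * \<alpha> - b0))\<^sup>2 \<le> (1 / real t)\<^sup>2"
    using sq by presburger+
  then have e0: "(cmod (r0 * \<alpha> - b0))\<^sup>2 \<le> 2 / (real t)\<^sup>2"
    unfolding cmod_power2 by (simp add: power_divide)
  obtain g x y where g: "g \<in> gauss_ints" "x \<in> gauss_ints" "y \<in> gauss_ints" "g \<noteq> 0"
    "g = x * b0 + y * r0" "gdvd g b0" "gdvd g r0"
    using gauss_bezout[OF G(2,1)] r0 by blast
  obtain b r where br: "b \<in> gauss_ints" "b0 = g * b" "r \<in> gauss_ints" "r0 = g * r"
    using g(6,7) unfolding gdvd_def by auto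
  have g1: "1 \<le> (cmod g)\<^sup>2" using cmod_gauss_ge_1[OF g(1,4)] by (rule one_le_power)
  have "g * 1 = g * (x * b + y * r)" using g(5) br(2,4) by (simp add: algebra_simps)
  then have "1 = x * b + y * r" using g(4) mult_left_cancel by blast
  moreover have "(cmod r)\<^sup>2 \<le> 2 * (real t)\<^sup>2"
  proof -
    have "1 * (cmod r)\<^sup>2 \<le> (cmod g)\<^sup>2 * (cmod r)\<^sup>2" using g1 by (intro mult_right_mono) auto
    then show ?thesis using r0_le by (simp add: br(4) norm_mult power_mult_distrib)
  qed
  moreover have "(cmod (r * \<alpha> - b))\<^sup>2 \<le> 2 / (real t)\<^sup>2"
  proof -
    have "r0 * \<alpha> - b0 = g * (r * \<alpha> - b)" using br(2,4) by (simp add: algebra_simps)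
    moreover have "1 * (cmod (r * \<alpha> - b))\<^sup>2 \<le> (cmod g)\<^sup>2 * (cmod (r * \<alpha> - b))\<^sup>2"
      using g1 by (intro mult_right_mono) auto
    ultimately show ?thesis using e0 by (simp add: norm_mult power_mult_distrib)
  qed
  moreover have "r \<noteq> 0" using r0 br(4) by auto
  ultimately show ?thesis using that br(1,3) g(2,3) by blast
qed

text \<open>Take \<open>t\<close> to be the integer part of N^(1/4), where both parts of |r|^2
  \<tau>^2 are O(1 / sqrt N). The hypothesis on \<rho> fits the sieve radius 2 / H with sqrt N <= 2
  H.\<close>

lemma card_square_fractions:
  assumes "0 < \<epsilon>"
  shows "\<exists>K>0. \<forall>Q N \<rho> \<alpha>. 0 \<le> Q \<longrightarrow> 1 \<le> N \<longrightarrow> 0 < \<rho> \<longrightarrow> \<rho>\<^sup>2 \<le> 16 / N \<longrightarrow>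
    real (card (square_fractions Q \<rho> \<alpha>)) \<le> K * N powr \<epsilon> * (1 + Q\<^sup>2 / sqrt N + Q ^ 3 / N)"
proof -
  obtain C where C: "0 < C" "\<And>r. r \<in> gauss_ints \<Longrightarrow> r \<noteq> 0 \<Longrightarrow> real (card (gdivisors r)) \<le> C * cmod r powr \<epsilon>"
    using gauss_divisor_bound[OF assms] by blast
  \<comment> \<open>18 counts the pairs with m = 0; 147456 is the constant for nonzero
    \<open>m\<close>, 40 that of the bracket below, and C * 2^\<epsilon> comes from the divisors of
    \<open>r\<close>.\<close>
  define K where "K = 18 + 147456 * 40 * C * 2 powr \<epsilon>"
  show ?thesis
  proof (intro exI[of _ K] conjI allI impI)
    show "0 < K" using C(1) by (simp add: K_def add_pos_nonneg)
    fix Q N \<rho> :: real and \<alpha> :: complex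
    assume Q: "0 \<le> Q" and N: "1 \<le> N" and \<rho>: "0 < \<rho>" "\<rho>\<^sup>2 \<le> 16 / N"
    define s where "s = sqrt (sqrt N)"
    define t where "t = nat \<lfloor>s\<rfloor>"
    have s1: "1 \<le> s" using N by (simp add: s_def)
    have s2: "s\<^sup>2 = sqrt N" and s4: "(s\<^sup>2)\<^sup>2 = N" using N by (simp_all add: s_def)
    have "1 \<le> \<lfloor>s\<rfloor>" "real t = of_int \<lfloor>s\<rfloor>" using s1 unfolding t_def by simp_all
    then have t: "1 \<le> t" "real t \<le> s" "s \<le> 2 * real t" by linarith+
    obtain r b x y where r: "r \<in> gauss_ints" "b \<in> gauss_ints" "r \<noteq> 0"
      and xy: "x \<in> gauss_ints" "y \<in> gauss_ints" "1 = x * b + y * r"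
      and rle: "(cmod r)\<^sup>2 \<le> 2 * (real t)\<^sup>2" and zle: "(cmod (r * \<alpha> - b))\<^sup>2 \<le> 2 / (real t)\<^sup>2"
      using gauss_dirichlet[OF t(1)] by blast
    define \<tau> where "\<tau> = max \<rho> (cmod (\<alpha> - b / r))"
    let ?d = "real (card (gdivisors r))"
    have t2: "(real t)\<^sup>2 \<le> sqrt N" unfolding s2[symmetric] using t by (intro power_mono) auto
    have "s\<^sup>2 \<le> (2 * real t)\<^sup>2" using t s1 by (intro power_mono) auto
    then have t2': "sqrt N \<le> 4 * (real t)\<^sup>2" unfolding s2 by (simp add: power_mult_distrib)
    have sN: "0 < sqrt N" "sqrt N * sqrt N = N" using N by auto
    have r2: "(cmod r)\<^sup>2 \<le> 2 * sqrt N" using rle t2 by linarith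
    \<comment> \<open>The bound |r| <= 2N is far from sharp, but it costs only in the exponent, and
      \<epsilon> is arbitrary.\<close>
    have dbound: "?d \<le> C * 2 powr \<epsilon> * N powr \<epsilon>"
    proof -
      have "2 * sqrt N \<le> (2 * N)\<^sup>2"
      proof -
        have "2 * sqrt N \<le> 4 * N" using N sN by (smt (verit) real_sqrt_le_iff sqrt_le_D mult_left_le real_sqrt_ge_1_iff mult_le_cancel_right1)
        also have "\<dots> \<le> (2 * N)\<^sup>2" using N by (simp add: power2_eq_square)
        finally show ?thesis .
      qed
      then have "(cmod r)\<^sup>2 \<le> (2 * N)\<^sup>2" using r2 by linarith
      then have "cmod r \<le> 2 * N" by (rule power2_le_imp_le) (use N in simp)
      then have "cmod r powr \<epsilon> \<le> (2 * N) powr \<epsilon>" using assms by (intro powr_mono2) auto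
      also have "\<dots> = 2 powr \<epsilon> * N powr \<epsilon>" using N by (simp add: powr_mult)
      finally have "C * cmod r powr \<epsilon> \<le> C * (2 powr \<epsilon> * N powr \<epsilon>)" using C(1) by simp
      then show ?thesis using C(2)[OF r(1,3)] by simp
    qed
    have rz: "(cmod r)\<^sup>2 * (cmod (\<alpha> - b / r))\<^sup>2 \<le> 8 / sqrt N"
    proof -
      have "(cmod r)\<^sup>2 * (cmod (\<alpha> - b / r))\<^sup>2 = (cmod (r * (\<alpha> - b / r)))\<^sup>2"
        by (simp add: norm_mult power_mult_distrib)
      also have "r * (\<alpha> - b / r) = r * \<alpha> - b" using r(3) by (simp add: algebra_simps)
      also have "(cmod (r * \<alpha> - b))\<^sup>2 \<le> 2 / (real t)\<^sup>2" by (rule zle)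
      also have "\<dots> \<le> 8 / sqrt N" using t2' t sN by (simp add: field_simps)
      finally show ?thesis .
    qed
    have r\<rho>: "(cmod r)\<^sup>2 * \<rho>\<^sup>2 \<le> 32 / sqrt N"
    proof -
      have "(cmod r)\<^sup>2 * \<rho>\<^sup>2 \<le> (2 * sqrt N) * (16 / (sqrt N * sqrt N))"
        using r2 \<rho> sN by (intro mult_mono) auto
      also have "\<dots> = 32 / sqrt N" using sN(1) by (simp add: field_simps)
      finally show ?thesis .
    qed
    \<comment> \<open>40 = 32 + 8, one summand for each entry of the maximum.\<close>
    have "(cmod r)\<^sup>2 * \<tau>\<^sup>2 \<le> 40 / sqrt N"
    proof -
      have "\<tau>\<^sup>2 \<le> \<rho>\<^sup>2 + (cmod (\<alpha> - b / r))\<^sup>2" by (auto simp: \<tau>_def max_def)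
      then have "(cmod r)\<^sup>2 * \<tau>\<^sup>2 \<le> (cmod r)\<^sup>2 * (\<rho>\<^sup>2 + (cmod (\<alpha> - b / r))\<^sup>2)" by (intro mult_left_mono) auto
      then show ?thesis using rz r\<rho> by (simp add: distrib_left)
    qed
    then have "Q\<^sup>2 * ((cmod r)\<^sup>2 * \<tau>\<^sup>2) \<le> Q\<^sup>2 * (40 / sqrt N)" by (intro mult_left_mono) auto
    moreover have "Q ^ 3 * \<rho>\<^sup>2 \<le> Q ^ 3 * (40 / N)"
    proof -
      have "\<rho>\<^sup>2 \<le> 40 / N" using \<rho>(2) N by (smt (verit) divide_right_mono)
      then show ?thesis using Q by (intro mult_left_mono) auto
    qed
    ultimately have inner: "(cmod r)\<^sup>2 * Q\<^sup>2 * \<tau>\<^sup>2 + Q ^ 3 * \<rho>\<^sup>2 \<le> 40 * (1 + Q\<^sup>2 / sqrt N + Q ^ 3 / N)"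
      by (simp add: algebra_simps)
    let ?E = "1 + Q\<^sup>2 / sqrt N + Q ^ 3 / N"
    have E: "1 \<le> ?E" using Q N by simp
    have N\<epsilon>: "1 \<le> N powr \<epsilon>" using N assms by (simp add: ge_one_powr_ge_zero)
    let ?F0 = "{(q, a) \<in> square_fractions Q \<rho> \<alpha>. a * r - b * q\<^sup>2 = 0}"
    let ?F1 = "{(q, a) \<in> square_fractions Q \<rho> \<alpha>. a * r - b * q\<^sup>2 \<noteq> 0}"
    have "square_fractions Q \<rho> \<alpha> = ?F0 \<union> ?F1" by auto
    then have "card (square_fractions Q \<rho> \<alpha>) = card (?F0 \<union> ?F1)" by (rule arg_cong)
    also have "\<dots> \<le> card ?F0 + card ?F1" by (rule card_Un_le)
    finally have "real (card (square_fractions Q \<rho> \<alpha>)) \<le> real (card ?F0 + card ?F1)"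
      by (rule of_nat_mono)
    also have "\<dots> = real (card ?F0) + real (card ?F1)" by (rule of_nat_add)
    also have "\<dots> \<le> 18 + 147456 * ?d * ((cmod r)\<^sup>2 * Q\<^sup>2 * \<tau>\<^sup>2 + Q ^ 3 * \<rho>\<^sup>2)"
      using card_square_fractions_eq[OF r xy, of Q \<rho> \<alpha>]
        card_square_fractions_neq[OF r(1,3,2) xy \<rho>(1) Q \<tau>_def] by (intro add_mono) auto
    also have "\<dots> \<le> 18 * (1 * 1) + 147456 * (C * 2 powr \<epsilon> * N powr \<epsilon>) * (40 * ?E)"
      using dbound inner Q C(1) by (intro add_mono mult_mono) auto
    also have "\<dots> \<le> 18 * (N powr \<epsilon> * ?E) + 147456 * (C * 2 powr \<epsilon> * N powr \<epsilon>) * (40 * ?E)"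
      using E N\<epsilon> C(1) by (intro add_mono mult_left_mono mult_mono) auto
    also have "\<dots> = K * N powr \<epsilon> * ?E" by (simp add: K_def algebra_simps)
    finally show "real (card (square_fractions Q \<rho> \<alpha>)) \<le> K * N powr \<epsilon> * ?E" .
  qed
qed

section \<open>The large sieve\<close>

lemma ee_add: "ee (x + y) = ee x * ee y"
  by (simp add: ee_def distrib_left exp_add)

lemma ee_minus: "ee (- x) = cnj (ee x)"
  by (simp add: ee_def exp_cnj)

lemma ee_Ints: "x \<in> \<int> \<Longrightarrow> ee x = 1"
  unfolding ee_def by (subst exp_eq_1) (auto elim!: Ints_cases)

lemma cmod_ee [simp]: "cmod (ee x) = 1"
  by (simp add: ee_def)

text \<open>|e(x) - 1| = 2 |sin y| with y = pi x. As |y| < 2, the cubic Taylor error |y|^3 / 6 is at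
  most 2 |y| / 3, so |sin y| >= |y| / 3; then use pi > 3.\<close>

lemma cmod_ee_minus_1_ge:
  assumes "\<bar>x\<bar> \<le> 1/2"
  shows "\<bar>x\<bar> \<le> cmod (ee x - 1)"
proof -
  let ?y = "pi * x"
  have "cmod (ee x - 1) = 2 * \<bar>sin ?y\<bar>"
    using dist_exp_i_1[of "2 * pi * x"] by (simp add: ee_def mult_ac)
  moreover have y: "\<bar>?y\<bar> < 2"
  proof -
    have "\<bar>?y\<bar> \<le> pi * (1/2)" using assms by (simp add: abs_mult)
    then show ?thesis using pi_less_4 by linarith
  qed
  have "\<bar>sin ?y - (\<Sum>m<3. sin_coeff m * ?y ^ m)\<bar> \<le> inverse (fact 3) * \<bar>?y\<bar> ^ 3"
    by (rule Maclaurin_sin_bound)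
  then have "\<bar>sin ?y - ?y\<bar> \<le> \<bar>?y\<bar> ^ 3 / 6"
    by (simp add: numeral_3_eq_3 sin_coeff_def fact_numeral)
  moreover have "\<bar>?y\<bar> ^ 3 \<le> 4 * \<bar>?y\<bar>"
  proof -
    have "\<bar>?y\<bar> ^ 2 \<le> 2 ^ 2" using y by (intro power_mono) auto
    then have "\<bar>?y\<bar> ^ 2 * \<bar>?y\<bar> \<le> 4 * \<bar>?y\<bar>" by (intro mult_right_mono) auto
    then show ?thesis by (simp add: power3_eq_cube power2_eq_square)
  qed
  ultimately have "2 / 3 * \<bar>?y\<bar> \<le> cmod (ee x - 1)" by linarith
  moreover have "\<bar>x\<bar> * 3 \<le> \<bar>x\<bar> * pi" using pi_gt3 by (intro mult_left_mono) auto
  ultimately show ?thesis by (simp add: abs_mult mult.commute)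
qed

text \<open>The Dirichlet kernel up to a phase; the start is free because the two index sets of the
  sieve begin at different integers.\<close>

definition geom :: "int \<Rightarrow> nat \<Rightarrow> real \<Rightarrow> complex" where
  "geom a L x = (\<Sum>k\<in>{a..<a + int L}. ee (of_int k * x))"

lemma cmod_geom_le: "cmod (geom a L x) \<le> L"
proof -
  have "cmod (geom a L x) \<le> (\<Sum>k\<in>{a..<a + int L}. cmod (ee (of_int k * x)))"
    unfolding geom_def by (rule norm_sum)
  then show ?thesis by simp
qed

lemma geom_telescope: "geom a L x * (ee x - 1) = ee (of_int (a + int L) * x) - ee (of_int a * x)"
proof (induction L)
  case (Suc L)
  have "{a..<a + int (Suc L)} = insert (a + int L) {a..<a + int L}" by auto
  then have "geom a (Suc L) x = ee (of_int (a + int L) * x) + geom a L x"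
    by (simp add: geom_def)
  moreover have "ee (of_int (a + int (Suc L)) * x) = ee (of_int (a + int L) * x) * ee x"
    unfolding ee_add[symmetric] by (simp add: algebra_simps)
  ultimately show ?case using Suc by (simp add: algebra_simps)
qed (simp add: geom_def)

text \<open>Telescoping turns the product with e(x) - 1 into a difference of two numbers of modulus
  1. The integer \<kappa> reduces \<open>x\<close> modulo 1; the product form covers distance 0 as
  well.\<close>

lemma cmod_geom_le_inverse:
  assumes "\<kappa> \<in> \<int>" "\<bar>x + \<kappa>\<bar> \<le> 1/2"
  shows "cmod (geom a L x) * \<bar>x + \<kappa>\<bar> \<le> 2"
proof -
  have "ee x = ee (x + \<kappa>)" using assms(1) by (simp add: ee_add ee_Ints)
  then have "cmod (geom a L x) * \<bar>x + \<kappa>\<bar> \<le> cmod (geom a L x) * cmod (ee x - 1)"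
    using cmod_ee_minus_1_ge[OF assms(2)] by (intro mult_left_mono) auto
  also have "\<dots> = cmod (ee (of_int (a + int L) * x) - ee (of_int a * x))"
    unfolding norm_mult[symmetric] geom_telescope ..
  also have "\<dots> \<le> 1 + 1" using norm_triangle_ineq4 by (metis cmod_ee)
  finally show ?thesis by simp
qed

text \<open>Two kernels of lengths 3H and H at distance |u| from the integers have product at most
  min(3 H^2, 4 / u^2). It is rewritten through the integer part of \<open>H * u\<close>, to depend
  only on a cell of side 1 / H. The quantity \<open>?w\<close> is at most 3 if H |u| <= 1 and at
  most 3 H |u| otherwise, so the constants are 27 and 36.\<close>

lemma kernel_bound:
  assumes "0 \<le> d" "0 \<le> e" "d \<le> 3 * H" "d * \<bar>u\<bar> \<le> 2" "e \<le> H" "e * \<bar>u\<bar> \<le> 2" "0 < H"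
  shows "d * e \<le> 36 * H\<^sup>2 / (1 + \<bar>real_of_int \<lfloor>H * u\<rfloor>\<bar>)\<^sup>2"
proof -
  let ?w = "1 + \<bar>real_of_int \<lfloor>H * u\<rfloor>\<bar>"
  have w: "?w \<le> 2 + H * \<bar>u\<bar>" "0 < ?w"
  proof -
    have "\<bar>H * u\<bar> = H * \<bar>u\<bar>" using assms(7) by (simp add: abs_mult)
    then show "?w \<le> 2 + H * \<bar>u\<bar>" by linarith
  qed auto
  have "d * e * ?w\<^sup>2 \<le> 36 * H\<^sup>2"
  proof (cases "H * \<bar>u\<bar> \<le> 1")
    case True
    then have "?w\<^sup>2 \<le> 3\<^sup>2" using w by (intro power_mono) linarith+
    then have "d * e * ?w\<^sup>2 \<le> (3 * H) * H * 3\<^sup>2"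
      using assms by (intro mult_mono) auto
    also have "\<dots> \<le> 36 * H\<^sup>2" by (simp add: power2_eq_square)
    finally show ?thesis .
  next
    case False
    then have "?w\<^sup>2 \<le> (3 * (H * \<bar>u\<bar>))\<^sup>2" using w by (intro power_mono) linarith+
    then have "d * e * ?w\<^sup>2 \<le> d * e * (3 * (H * \<bar>u\<bar>))\<^sup>2"
      using assms(1,2) by (intro mult_left_mono) auto
    also have "\<dots> = 9 * H\<^sup>2 * ((d * \<bar>u\<bar>) * (e * \<bar>u\<bar>))"
      by (simp add: power2_eq_square algebra_simps)
    also have "\<dots> \<le> 9 * H\<^sup>2 * (2 * 2)"
      using assms by (intro mult_left_mono mult_mono) auto
    finally show ?thesis by simp
  qed
  then show ?thesis using w(2) by (simp add: pos_le_divide_eq)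
qed

text \<open>The correction 2 / (n + 1) lets the induction close: 2 / (n + 2)^2 <= 2 / (n + 1) - 2 /
  (n + 2).\<close>

lemma sum_inverse_squares_le:
  "(\<Sum>i\<in>{- int n..int n}. 1 / (1 + \<bar>real_of_int i\<bar>)\<^sup>2) \<le> 4 - 2 / (real n + 1)"
proof (induction n)
  case (Suc n)
  have "{- int (Suc n)..int (Suc n)} = insert (int (Suc n)) (insert (- int (Suc n)) {- int n..int n})"
    by auto
  then have "(\<Sum>i\<in>{- int (Suc n)..int (Suc n)}. 1 / (1 + \<bar>real_of_int i\<bar>)\<^sup>2)
      = 2 / (real n + 2)\<^sup>2 + (\<Sum>i\<in>{- int n..int n}. 1 / (1 + \<bar>real_of_int i\<bar>)\<^sup>2)"
    by (simp add: algebra_simps)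
  also have "\<dots> \<le> 2 / (real n + 2)\<^sup>2 + (4 - 2 / (real n + 1))" using Suc by simp
  also have "\<dots> \<le> 4 - 2 / (real (Suc n) + 1)"
    by (simp add: divide_simps power2_eq_square) (simp add: algebra_simps)
  finally show ?case .
qed simp

text \<open>Let X be the left side. Expanding one factor of each square gives X as the sum of
  \<open>c j * y j\<close>, and Cauchy-Schwarz reduces the claim to bounding the sum of |y j|^2 by W
  X. That is a Schur test on the Gram matrix: 2 |T s| |T t| <= |T s|^2 + |T t|^2 and the symmetry of
  |I s t| leave only row sums.\<close>

lemma large_sieve_duality:
  fixes \<phi> :: "'s \<Rightarrow> 'j \<Rightarrow> complex"
  assumes W: "\<And>s. s \<in> S \<Longrightarrow> (\<Sum>t\<in>S. cmod (\<Sum>j\<in>J. \<phi> s j * cnj (\<phi> t j))) \<le> W" and W0: "0 \<le> W"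
  shows "(\<Sum>s\<in>S. (cmod (\<Sum>j\<in>J. c j * \<phi> s j))\<^sup>2) \<le> W * (\<Sum>j\<in>J. (cmod (c j))\<^sup>2)"
proof -
  define T where "T s = (\<Sum>j\<in>J. c j * \<phi> s j)" for s
  define I where "I s t = (\<Sum>j\<in>J. \<phi> s j * cnj (\<phi> t j))" for s t
  define y where "y j = (\<Sum>s\<in>S. cnj (T s) * \<phi> s j)" for j
  let ?X = "\<Sum>s\<in>S. (cmod (T s))\<^sup>2"
  have X0: "0 \<le> ?X" by (intro sum_nonneg) auto
  have sym: "cmod (I t s) = cmod (I s t)" for s t
  proof -
    have "I t s = cnj (I s t)" by (simp add: I_def mult.commute)
    then show ?thesis by simp
  qed
  have Y: "(\<Sum>j\<in>J. (cmod (y j))\<^sup>2) \<le> W * ?X"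
  proof -
    have "complex_of_real (\<Sum>j\<in>J. (cmod (y j))\<^sup>2) = (\<Sum>j\<in>J. y j * cnj (y j))"
      unfolding complex_norm_square[symmetric] by simp
    also have "\<dots> = (\<Sum>j\<in>J. \<Sum>s\<in>S. \<Sum>t\<in>S. cnj (T s) * \<phi> s j * (T t * cnj (\<phi> t j)))"
      by (simp add: y_def sum_product)
    also have "\<dots> = (\<Sum>s\<in>S. \<Sum>t\<in>S. \<Sum>j\<in>J. cnj (T s) * \<phi> s j * (T t * cnj (\<phi> t j)))"
      by (subst sum.swap) (intro sum.cong refl sum.swap)
    also have "\<dots> = (\<Sum>s\<in>S. \<Sum>t\<in>S. cnj (T s) * T t * I s t)"
      by (simp add: I_def sum_distrib_left mult_ac)
    finally have eq: "complex_of_real (\<Sum>j\<in>J. (cmod (y j))\<^sup>2) = (\<Sum>s\<in>S. \<Sum>t\<in>S. cnj (T s) * T t * I s t)" .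
    have "(\<Sum>j\<in>J. (cmod (y j))\<^sup>2) = cmod (complex_of_real (\<Sum>j\<in>J. (cmod (y j))\<^sup>2))"
      by (simp only: norm_of_real) (simp add: sum_nonneg)
    also have "\<dots> \<le> (\<Sum>s\<in>S. \<Sum>t\<in>S. cmod (cnj (T s) * T t * I s t))"
      unfolding eq by (intro order_trans[OF norm_sum] sum_mono norm_sum)
    also have "\<dots> \<le> (\<Sum>s\<in>S. \<Sum>t\<in>S. (cmod (T s))\<^sup>2 * cmod (I s t) / 2 + (cmod (T t))\<^sup>2 * cmod (I s t) / 2)"
    proof (intro sum_mono)
      fix s t
      have "2 * (cmod (T s) * cmod (T t)) \<le> (cmod (T s))\<^sup>2 + (cmod (T t))\<^sup>2"
        using sum_squares_bound[of "cmod (T s)" "cmod (T t)"] by simp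
      then have "2 * (cmod (T s) * cmod (T t)) * cmod (I s t) \<le> ((cmod (T s))\<^sup>2 + (cmod (T t))\<^sup>2) * cmod (I s t)"
        by (intro mult_right_mono) auto
      then show "cmod (cnj (T s) * T t * I s t) \<le> (cmod (T s))\<^sup>2 * cmod (I s t) / 2 + (cmod (T t))\<^sup>2 * cmod (I s t) / 2"
        by (simp add: norm_mult algebra_simps)
    qed
    also have "\<dots> = (\<Sum>s\<in>S. \<Sum>t\<in>S. (cmod (T s))\<^sup>2 * cmod (I s t) / 2) + (\<Sum>s\<in>S. \<Sum>t\<in>S. (cmod (T t))\<^sup>2 * cmod (I s t) / 2)"
      by (simp add: sum.distrib)
    also have "(\<Sum>s\<in>S. \<Sum>t\<in>S. (cmod (T t))\<^sup>2 * cmod (I s t) / 2) = (\<Sum>t\<in>S. \<Sum>s\<in>S. (cmod (T t))\<^sup>2 * cmod (I t s) / 2)"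
      by (subst sum.swap) (simp add: sym)
    also have "(\<Sum>s\<in>S. \<Sum>t\<in>S. (cmod (T s))\<^sup>2 * cmod (I s t) / 2) + \<dots> = (\<Sum>s\<in>S. (cmod (T s))\<^sup>2 * (\<Sum>t\<in>S. cmod (I s t)))"
      by (simp add: sum_distrib_left sum_divide_distrib[symmetric])
    also have "\<dots> \<le> (\<Sum>s\<in>S. (cmod (T s))\<^sup>2 * W)"
      using W unfolding I_def by (intro sum_mono mult_left_mono) auto
    also have "\<dots> = W * ?X" by (simp add: sum_distrib_left mult.commute)
    finally show ?thesis .
  qed
  have "complex_of_real ?X = (\<Sum>s\<in>S. cnj (T s) * T s)"
    unfolding mult.commute[of "cnj _"] complex_norm_square[symmetric] by simp
  also have "\<dots> = (\<Sum>s\<in>S. \<Sum>j\<in>J. c j * (cnj (T s) * \<phi> s j))"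
    by (rule sum.cong[OF refl], subst (2) T_def) (simp add: sum_distrib_left mult_ac)
  also have "\<dots> = (\<Sum>j\<in>J. c j * y j)"
    by (subst sum.swap) (simp add: y_def sum_distrib_left)
  finally have "?X = cmod (\<Sum>j\<in>J. c j * y j)"
    using X0 by (metis abs_of_nonneg norm_of_real)
  also have "\<dots> \<le> (\<Sum>j\<in>J. cmod (c j) * cmod (y j))"
    using norm_sum[of "\<lambda>j. c j * y j" J] by (simp add: norm_mult)
  finally have "?X\<^sup>2 \<le> (\<Sum>j\<in>J. cmod (c j) * cmod (y j))\<^sup>2" using X0 by (intro power_mono) auto
  also have "\<dots> \<le> (\<Sum>j\<in>J. (cmod (c j))\<^sup>2) * (\<Sum>j\<in>J. (cmod (y j))\<^sup>2)"
    by (rule Cauchy_Schwarz_ineq_sum)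
  also have "\<dots> \<le> (\<Sum>j\<in>J. (cmod (c j))\<^sup>2) * (W * ?X)"
    using Y by (intro mult_left_mono sum_nonneg) auto
  finally have "?X * ?X \<le> (W * (\<Sum>j\<in>J. (cmod (c j))\<^sup>2)) * ?X"
    by (simp add: power2_eq_square mult_ac)
  then have "?X \<le> W * (\<Sum>j\<in>J. (cmod (c j))\<^sup>2)"
  proof (cases "?X = 0")
    case True
    then show ?thesis using W0 by (simp add: sum_nonneg)
  next
    case False
    then have "0 < ?X" using X0 by linarith
    then show ?thesis
      using \<open>?X * ?X \<le> (W * (\<Sum>j\<in>J. (cmod (c j))\<^sup>2)) * ?X\<close> mult_le_cancel_right_pos by blast
  qed
  then show ?thesis by (simp add: T_def)
qed

section \<open>The two-dimensional sieve inequality\<close>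

definition gint :: "int \<times> int \<Rightarrow> complex" where
  "gint p = Complex (of_int (fst p)) (of_int (snd p))"

lemma gint_eq_iff: "gint p = gint p' \<longleftrightarrow> p = p'"
  by (auto simp: gint_def prod_eq_iff)

text \<open>Re((x + iy) \<beta>) = x Re \<beta> - y Im \<beta>, so the sum over a square factors,
  and the minus sign appears.\<close>

lemma sum_ee_square:
  "(\<Sum>p\<in>{a..<a + int L} \<times> {a..<a + int L}. ee (Re (gint p * \<beta>))) = geom a L (Re \<beta>) * geom a L (- Im \<beta>)"
proof -
  have "geom a L (Re \<beta>) * geom a L (- Im \<beta>) =
    (\<Sum>x\<in>{a..<a + int L}. \<Sum>y\<in>{a..<a + int L}. ee (of_int x * Re \<beta>) * ee (of_int y * (- Im \<beta>)))"
    unfolding geom_def by (rule sum_product)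
  also have "\<dots> = (\<Sum>(x, y)\<in>{a..<a + int L} \<times> {a..<a + int L}. ee (of_int x * Re \<beta>) * ee (of_int y * (- Im \<beta>)))"
    by (rule sum.cartesian_product)
  also have "\<dots> = (\<Sum>p\<in>{a..<a + int L} \<times> {a..<a + int L}. ee (Re (gint p * \<beta>)))"
    by (rule sum.cong) (auto simp: gint_def ee_add[symmetric])
  finally show ?thesis by simp
qed

text \<open>Duality is applied on the index set \<open>J \<times> K\<close>, on which \<open>j - k\<close> takes every value in
  \<open>B\<close> exactly \<open>H\<^sup>2\<close> times. The Gram matrix then is a product of two Dirichlet kernels
  in each coordinate, whose quadratic decay makes its row sums converge.\<close>

lemma gauss_large_sieve:
  fixes \<alpha> :: "'s \<Rightarrow> complex" and H :: nat
  assumes S: "finite S" and H: "1 \<le> H"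
    and B: "B \<subseteq> {n \<in> gauss_ints. \<bar>Re n\<bar> \<le> H \<and> \<bar>Im n\<bar> \<le> H}"
    and P: "\<And>\<beta>. real (card {s \<in> S. \<exists>k\<in>gauss_ints. cmod (\<alpha> s + k - \<beta>) \<le> 2 / H}) \<le> P"
  shows "(\<Sum>s\<in>S. (cmod (\<Sum>n\<in>B. c n * ee (Re (n * \<alpha> s))))\<^sup>2)
    \<le> 20736 * P * (real H)\<^sup>2 * (\<Sum>n\<in>B. (cmod (c n))\<^sup>2)"
proof -
  \<comment> \<open>In each coordinate j = n + k with |n| <= H and 0 <= k < H ranges from -H to 2H -
    1, so \<open>I1\<close> has length 3H.\<close>
  define I1 where "I1 = {- int H..<- int H + int (3 * H)}"
  define I2 where "I2 = {0..<0 + int H}"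
  define J where "J = I1 \<times> I1"
  define K where "K = I2 \<times> I2"
  define \<phi> where "\<phi> s p = ee (Re ((gint (fst p) - gint (snd p)) * \<alpha> s))" for s p
  define d where "d p = (if gint (fst p) - gint (snd p) \<in> B then c (gint (fst p) - gint (snd p)) else 0)" for p
  define w where "w i = 1 / (1 + \<bar>real_of_int i\<bar>)\<^sup>2" for i
  let ?R = "{- int H..int H}"
  have w0: "0 \<le> w i" for i by (simp add: w_def)
  have P0: "0 \<le> P" using P[of 0] by (rule order_trans[rotated]) simp
  have finJK: "finite J" "finite K" by (simp_all add: J_def K_def I1_def I2_def)
  have cardK: "card K = H\<^sup>2" by (simp add: K_def I2_def card_cartesian_product power2_eq_square)
  have slice: "(\<Sum>j\<in>J. if gint j - gint k \<in> B then F (gint j - gint k) else 0) = (\<Sum>n\<in>B. F n)"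
    if k: "k \<in> K" for k and F :: "complex \<Rightarrow> 'v::comm_monoid_add"
  proof -
    have "(\<Sum>j\<in>J. if gint j - gint k \<in> B then F (gint j - gint k) else 0)
        = (\<Sum>j\<in>{j \<in> J. gint j - gint k \<in> B}. F (gint j - gint k))"
      using finJK by (simp add: sum.inter_filter)
    also have "\<dots> = (\<Sum>n\<in>B. F n)"
    proof (rule sum.reindex_bij_betw)
      show "bij_betw (\<lambda>j. gint j - gint k) {j \<in> J. gint j - gint k \<in> B} B"
      proof (rule bij_betw_imageI)
        show "inj_on (\<lambda>j. gint j - gint k) {j \<in> J. gint j - gint k \<in> B}"
          by (intro inj_onI) (simp add: gint_eq_iff)
        show "(\<lambda>j. gint j - gint k) ` {j \<in> J. gint j - gint k \<in> B} = B"
        proof (intro equalityI subsetI)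
          fix n assume n: "n \<in> B"
          then have "n \<in> gauss_ints" and le: "\<bar>Re n\<bar> \<le> H" "\<bar>Im n\<bar> \<le> H" using B by auto
          then obtain x y where xy: "Re n = of_int x" "Im n = of_int y"
            by (auto simp: gauss_ints_def elim!: Ints_cases)
          let ?j = "(x + fst k, y + snd k)"
          have eq: "gint ?j - gint k = n" using xy by (simp add: gint_def complex_eq_iff)
          have "\<bar>x\<bar> \<le> int H" "\<bar>y\<bar> \<le> int H" using le xy by linarith+
          then have "?j \<in> J" using k H by (auto simp: J_def K_def I1_def I2_def)
          then show "n \<in> (\<lambda>j. gint j - gint k) ` {j \<in> J. gint j - gint k \<in> B}"
            using eq n by (intro image_eqI[of _ _ ?j]) auto
        qed auto
      qed
    qed
    finally show ?thesis .
  qed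
  have fold: "(\<Sum>p\<in>J \<times> K. if gint (fst p) - gint (snd p) \<in> B then F (gint (fst p) - gint (snd p)) else 0)
      = of_nat (H\<^sup>2) * (\<Sum>n\<in>B. F n)" for F :: "complex \<Rightarrow> 'v::semiring_1"
  proof -
    have "(\<Sum>p\<in>J \<times> K. if gint (fst p) - gint (snd p) \<in> B then F (gint (fst p) - gint (snd p)) else 0)
      = (\<Sum>j\<in>J. \<Sum>k\<in>K. if gint j - gint k \<in> B then F (gint j - gint k) else 0)"
      by (simp add: sum.cartesian_product case_prod_beta)
    also have "\<dots> = (\<Sum>k\<in>K. \<Sum>j\<in>J. if gint j - gint k \<in> B then F (gint j - gint k) else 0)"
      by (rule sum.swap)
    also have "\<dots> = (\<Sum>k\<in>K. \<Sum>n\<in>B. F n)" by (rule sum.cong[OF refl slice])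
    finally show ?thesis by (simp add: cardK)
  qed
  have row: "(\<Sum>t\<in>S. cmod (\<Sum>p\<in>J \<times> K. \<phi> s p * cnj (\<phi> t p))) \<le> 20736 * (real H) ^ 4 * P" for s
  proof -
    \<comment> \<open>\<kappa> t is a Gaussian integer nearest to \<alpha> t - \<alpha> s in each
      coordinate, so \<open>u t\<close> is that difference reduced modulo Z[i];
      \<open>cell t\<close> names the square of side 1 / H containing it.\<close>
    define \<kappa> where "\<kappa> t = (SOME k. k \<in> gauss_ints \<and> \<bar>Re (\<alpha> t - \<alpha> s - k)\<bar> \<le> 1/2 \<and> \<bar>Im (\<alpha> t - \<alpha> s - k)\<bar> \<le> 1/2)" for t
    define u where "u t = \<alpha> t - \<alpha> s - \<kappa> t" for t
    define cell where "cell t = (\<lfloor>H * Re (u t)\<rfloor>, \<lfloor>H * Im (u t)\<rfloor>)" for t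
    have \<kappa>: "\<kappa> t \<in> gauss_ints" "\<bar>Re (u t)\<bar> \<le> 1/2" "\<bar>Im (u t)\<bar> \<le> 1/2" for t
      using someI_ex[of "\<lambda>k. k \<in> gauss_ints \<and> \<bar>Re (\<alpha> t - \<alpha> s - k)\<bar> \<le> 1/2 \<and> \<bar>Im (\<alpha> t - \<alpha> s - k)\<bar> \<le> 1/2"]
        gauss_round[of "\<alpha> t - \<alpha> s"] unfolding \<kappa>_def[symmetric] u_def by blast+
    have gram: "cmod (\<Sum>p\<in>J \<times> K. \<phi> s p * cnj (\<phi> t p)) \<le> 1296 * real H ^ 4 * (w (fst (cell t)) * w (snd (cell t)))" for t
    proof -
      let ?\<delta> = "\<alpha> s - \<alpha> t"
      have "(\<Sum>p\<in>J \<times> K. \<phi> s p * cnj (\<phi> t p))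
          = (\<Sum>p\<in>J \<times> K. ee (Re (gint (fst p) * ?\<delta>)) * ee (Re (gint (snd p) * - ?\<delta>)))"
        unfolding \<phi>_def ee_minus[symmetric] ee_add[symmetric]
        by (intro sum.cong refl arg_cong[of _ _ ee]) (simp add: algebra_simps)
      also have "\<dots> = (\<Sum>j\<in>J. \<Sum>k\<in>K. ee (Re (gint j * ?\<delta>)) * ee (Re (gint k * - ?\<delta>)))"
        unfolding sum.cartesian_product case_prod_beta ..
      also have "\<dots> = (\<Sum>j\<in>J. ee (Re (gint j * ?\<delta>))) * (\<Sum>k\<in>K. ee (Re (gint k * - ?\<delta>)))"
        by (rule sum_product[symmetric])
      also have "\<dots> = (geom (- int H) (3 * H) (Re ?\<delta>) * geom (- int H) (3 * H) (- Im ?\<delta>))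
          * (geom 0 H (Re (- ?\<delta>)) * geom 0 H (- Im (- ?\<delta>)))"
        unfolding J_def K_def I1_def I2_def sum_ee_square ..
      finally have eq: "cmod (\<Sum>p\<in>J \<times> K. \<phi> s p * cnj (\<phi> t p)) =
         (cmod (geom (- int H) (3 * H) (Re ?\<delta>)) * cmod (geom 0 H (- Re ?\<delta>))) *
         (cmod (geom (- int H) (3 * H) (- Im ?\<delta>)) * cmod (geom 0 H (Im ?\<delta>)))"
        by (simp add: norm_mult mult_ac)
      have Z: "Re (\<kappa> t) \<in> \<int>" "- Re (\<kappa> t) \<in> \<int>" "Im (\<kappa> t) \<in> \<int>" "- Im (\<kappa> t) \<in> \<int>"
        using \<kappa>(1)[of t] by (auto simp: gauss_ints_def)
      have abs: "\<bar>Re ?\<delta> + Re (\<kappa> t)\<bar> = \<bar>Re (u t)\<bar>" "\<bar>- Re ?\<delta> + - Re (\<kappa> t)\<bar> = \<bar>Re (u t)\<bar>"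
        "\<bar>Im ?\<delta> + Im (\<kappa> t)\<bar> = \<bar>Im (u t)\<bar>" "\<bar>- Im ?\<delta> + - Im (\<kappa> t)\<bar> = \<bar>Im (u t)\<bar>"
        by (simp_all add: u_def)
      note inv1 = cmod_geom_le_inverse[OF Z(1), of "Re ?\<delta>", unfolded abs, OF \<kappa>(2)]
      note inv2 = cmod_geom_le_inverse[OF Z(2), of "- Re ?\<delta>", unfolded abs, OF \<kappa>(2)]
      note inv3 = cmod_geom_le_inverse[OF Z(3), of "Im ?\<delta>", unfolded abs, OF \<kappa>(3)]
      note inv4 = cmod_geom_le_inverse[OF Z(4), of "- Im ?\<delta>", unfolded abs, OF \<kappa>(3)]
      have le3: "cmod (geom (- int H) (3 * H) x) \<le> 3 * real H" for x
        using cmod_geom_le[of "- int H" "3 * H" x] by simp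
      have "cmod (geom (- int H) (3 * H) (Re ?\<delta>)) * cmod (geom 0 H (- Re ?\<delta>))
          \<le> 36 * (real H)\<^sup>2 / (1 + \<bar>real_of_int \<lfloor>H * Re (u t)\<rfloor>\<bar>)\<^sup>2"
        using H by (intro kernel_bound le3 cmod_geom_le inv1 inv2) auto
      moreover have "cmod (geom (- int H) (3 * H) (- Im ?\<delta>)) * cmod (geom 0 H (Im ?\<delta>))
          \<le> 36 * (real H)\<^sup>2 / (1 + \<bar>real_of_int \<lfloor>H * Im (u t)\<rfloor>\<bar>)\<^sup>2"
        using H by (intro kernel_bound le3 cmod_geom_le inv3 inv4) auto
      ultimately have "cmod (\<Sum>p\<in>J \<times> K. \<phi> s p * cnj (\<phi> t p)) \<le>
          (36 * (real H)\<^sup>2 / (1 + \<bar>real_of_int \<lfloor>H * Re (u t)\<rfloor>\<bar>)\<^sup>2) *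
          (36 * (real H)\<^sup>2 / (1 + \<bar>real_of_int \<lfloor>H * Im (u t)\<rfloor>\<bar>)\<^sup>2)"
        unfolding eq by (intro mult_mono) auto
      also have "\<dots> = 1296 * real H ^ 4 * (w (fst (cell t)) * w (snd (cell t)))"
        by (simp add: w_def cell_def)
      finally show ?thesis .
    qed
    have cell_range: "cell ` S \<subseteq> ?R \<times> ?R"
    proof -
      have "\<lfloor>H * x\<rfloor> \<in> ?R" if "\<bar>x\<bar> \<le> 1/2" for x :: real
      proof -
        have "\<bar>H * x\<bar> \<le> H * (1/2)" using that unfolding abs_mult by (intro mult_mono) auto
        then have "\<bar>H * x\<bar> \<le> H" by linarith
        then have "- real_of_int (int H) \<le> H * x" "H * x \<le> H" by linarith+
        then show ?thesis by (simp add: le_floor_iff floor_le_iff)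
      qed
      then show ?thesis using \<kappa>(2,3) unfolding cell_def by auto
    qed
    \<comment> \<open>A point is within 1 / H of the corner of its cell in each coordinate, hence
      within 2 / H of \<beta> after the shift by -\<kappa> t.\<close>
    have count: "real (card {t \<in> S. cell t = z}) \<le> P" for z
    proof -
      define \<beta> where "\<beta> = \<alpha> s + Complex (of_int (fst z) / H) (of_int (snd z) / H)"
      have "{t \<in> S. cell t = z} \<subseteq> {t \<in> S. \<exists>k\<in>gauss_ints. cmod (\<alpha> t + k - \<beta>) \<le> 2 / H}"
      proof (clarify)
        fix t assume t: "t \<in> S" "z = cell t"
        have near: "\<bar>x - of_int \<lfloor>H * x\<rfloor> / H\<bar> \<le> 1 / H" for x :: real
        proof -
          have "\<bar>x - of_int \<lfloor>H * x\<rfloor> / H\<bar> * H = \<bar>(x - of_int \<lfloor>H * x\<rfloor> / H) * H\<bar>" by (simp add: abs_mult)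
          also have "(x - of_int \<lfloor>H * x\<rfloor> / H) * H = H * x - of_int \<lfloor>H * x\<rfloor>"
            using H by (simp add: field_simps)
          also have "\<bar>\<dots>\<bar> \<le> 1" by linarith
          finally show ?thesis using H by (simp add: pos_le_divide_eq)
        qed
        have eq: "\<alpha> t + - \<kappa> t - \<beta> = u t - Complex (of_int (fst z) / H) (of_int (snd z) / H)"
          by (simp add: \<beta>_def u_def)
        have "cmod (\<alpha> t + - \<kappa> t - \<beta>) \<le> 1 / H + 1 / H"
          unfolding eq
          by (rule order_trans[OF cmod_le] , rule add_mono) (simp_all add: t(2) cell_def near)
        then show "\<exists>k\<in>gauss_ints. cmod (\<alpha> t + k - \<beta>) \<le> 2 / H"
          using \<kappa>(1) by (intro bexI[of _ "- \<kappa> t"]) simp_all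
      qed
      then have "card {t \<in> S. cell t = z} \<le> card {t \<in> S. \<exists>k\<in>gauss_ints. cmod (\<alpha> t + k - \<beta>) \<le> 2 / H}"
        using S by (intro card_mono) auto
      then show ?thesis using P[of \<beta>] by linarith
    qed
    have wsum: "(\<Sum>i\<in>?R. w i) \<le> 4"
      using sum_inverse_squares_le[of H] unfolding w_def by (rule order_trans) simp
    \<comment> \<open>Grouping by cells: at most \<open>P\<close> points in each, and the weights
      sum to at most 4 in each coordinate. With 1296 = 36^2 this gives 20736 = 1296 * 16.\<close>
    have "(\<Sum>t\<in>S. w (fst (cell t)) * w (snd (cell t)))
        = (\<Sum>z\<in>?R \<times> ?R. \<Sum>t\<in>{t \<in> S. cell t = z}. w (fst (cell t)) * w (snd (cell t)))"
      using S cell_range by (intro sum.group[symmetric]) auto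
    also have "\<dots> = (\<Sum>z\<in>?R \<times> ?R. real (card {t \<in> S. cell t = z}) * (w (fst z) * w (snd z)))"
      by (intro sum.cong refl) simp
    also have "\<dots> \<le> (\<Sum>z\<in>?R \<times> ?R. P * (w (fst z) * w (snd z)))"
      using count w0 by (intro sum_mono mult_right_mono) auto
    also have "\<dots> = P * ((\<Sum>i\<in>?R. w i) * (\<Sum>i\<in>?R. w i))"
      unfolding sum_product sum.cartesian_product by (simp add: sum_distrib_left case_prod_beta)
    also have "\<dots> \<le> P * (4 * 4)"
      using wsum w0 P0 by (intro mult_left_mono mult_mono sum_nonneg) auto
    finally have ws: "(\<Sum>t\<in>S. w (fst (cell t)) * w (snd (cell t))) \<le> P * (4 * 4)" .
    have "(\<Sum>t\<in>S. cmod (\<Sum>p\<in>J \<times> K. \<phi> s p * cnj (\<phi> t p)))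
        \<le> (\<Sum>t\<in>S. 1296 * real H ^ 4 * (w (fst (cell t)) * w (snd (cell t))))"
      using gram by (rule sum_mono)
    also have "\<dots> = 1296 * real H ^ 4 * (\<Sum>t\<in>S. w (fst (cell t)) * w (snd (cell t)))"
      by (simp only: sum_distrib_left)
    also have "\<dots> \<le> 1296 * real H ^ 4 * (P * (4 * 4))"
      using ws by (intro mult_left_mono) auto
    finally show ?thesis by (simp add: mult_ac)
  qed
  have "(\<Sum>s\<in>S. (cmod (\<Sum>p\<in>J \<times> K. d p * \<phi> s p))\<^sup>2)
      \<le> 20736 * real H ^ 4 * P * (\<Sum>p\<in>J \<times> K. (cmod (d p))\<^sup>2)"
    using row P0 by (intro large_sieve_duality) auto
  also have "(\<Sum>p\<in>J \<times> K. (cmod (d p))\<^sup>2) = of_nat (H\<^sup>2) * (\<Sum>n\<in>B. (cmod (c n))\<^sup>2)"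
    unfolding fold[symmetric] by (intro sum.cong refl) (simp add: d_def)
  \<comment> \<open>Each difference occurs H^2 times, so the squared sums carry H^4 and the squared
    coefficients H^2; of H^4 * H^2 on the right only H^2 survives.\<close>
  also have "(\<Sum>s\<in>S. (cmod (\<Sum>p\<in>J \<times> K. d p * \<phi> s p))\<^sup>2)
      = real H ^ 4 * (\<Sum>s\<in>S. (cmod (\<Sum>n\<in>B. c n * ee (Re (n * \<alpha> s))))\<^sup>2)"
  proof -
    have T: "(\<Sum>p\<in>J \<times> K. d p * \<phi> s p) = of_nat (H\<^sup>2) * (\<Sum>n\<in>B. c n * ee (Re (n * \<alpha> s)))" for s
      unfolding fold[symmetric] by (intro sum.cong refl) (simp add: d_def \<phi>_def)
    have "(cmod (\<Sum>p\<in>J \<times> K. d p * \<phi> s p))\<^sup>2 = real H ^ 4 * (cmod (\<Sum>n\<in>B. c n * ee (Re (n * \<alpha> s))))\<^sup>2" for s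
      unfolding T norm_mult power_mult_distrib norm_of_nat by (simp add: power_mult[symmetric])
    then show ?thesis by (simp only: sum_distrib_left)
  qed
  finally have "real H ^ 4 * (\<Sum>s\<in>S. (cmod (\<Sum>n\<in>B. c n * ee (Re (n * \<alpha> s))))\<^sup>2)
      \<le> real H ^ 4 * (20736 * P * (real H)\<^sup>2 * (\<Sum>n\<in>B. (cmod (c n))\<^sup>2))"
    by (simp add: mult_ac)
  then show ?thesis using H by simp
qed

text \<open>Translating each element by a multiple of q^2 into the disc of radius |q^2| is
  injective, as distinct elements are incongruent. Over an infinite set the inner sum would be 0 by
  convention.\<close>

lemma finite_reduced_residue_system:
  assumes R: "reduced_residue_system q R" and q: "q \<in> gauss_ints" "q \<noteq> 0"
  shows "finite R"
proof -
  have "\<exists>k\<in>gauss_ints. cmod (a - k * q\<^sup>2) \<le> cmod (q\<^sup>2)" for a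
  proof -
    obtain k where k: "k \<in> gauss_ints" "\<bar>Re (a / q\<^sup>2 - k)\<bar> \<le> 1/2" "\<bar>Im (a / q\<^sup>2 - k)\<bar> \<le> 1/2"
      using gauss_round by blast
    have "cmod (a / q\<^sup>2 - k) \<le> 1" using cmod_le[of "a / q\<^sup>2 - k"] k(2,3) by linarith
    then have "cmod (a / q\<^sup>2 - k) * cmod (q\<^sup>2) \<le> 1 * cmod (q\<^sup>2)" by (intro mult_right_mono) auto
    moreover have "(a / q\<^sup>2 - k) * q\<^sup>2 = a - k * q\<^sup>2" using q by (simp add: field_simps)
    ultimately show ?thesis using k(1) by (metis mult_1 norm_mult)
  qed
  then obtain k where k: "\<And>a. k a \<in> gauss_ints" "\<And>a. cmod (a - k a * q\<^sup>2) \<le> cmod (q\<^sup>2)" by metis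
  have "inj_on (\<lambda>a. a - k a * q\<^sup>2) R"
  proof (rule inj_onI)
    fix a b assume ab: "a \<in> R" "b \<in> R" "a - k a * q\<^sup>2 = b - k b * q\<^sup>2"
    then have "a - b = q\<^sup>2 * (k a - k b)" by (simp add: algebra_simps)
    then have "gcong a b (q\<^sup>2)" using k(1) by (auto simp: gcong_def)
    then show "a = b" using R ab by (auto simp: reduced_residue_system_def)
  qed
  moreover have "(\<lambda>a. a - k a * q\<^sup>2) ` R \<subseteq> {z \<in> gauss_ints. cmod z \<le> cmod (q\<^sup>2)}"
    using k q R by (auto simp: reduced_residue_system_def subset_iff)
  ultimately show ?thesis using finite_gauss_ball inj_on_finite by blast
qed

text \<open>The shift \<open>k\<close> is absorbed into the numerator: a + q^2 k stays coprime to
  \<open>q\<close>, and incongruence of the residues keeps the map injective.\<close>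

lemma card_residues_near_le:
  assumes R: "\<And>q. q \<in> gauss_ints \<Longrightarrow> q \<noteq> 0 \<Longrightarrow> reduced_residue_system q (R q)"
  shows "card {s \<in> (SIGMA q:{q \<in> gauss_ints. q \<noteq> 0 \<and> gnorm q \<le> Q}. R q).
      \<exists>k\<in>gauss_ints. cmod (snd s / (fst s)\<^sup>2 + k - \<beta>) \<le> \<rho>} \<le> card (square_fractions Q \<rho> \<beta>)"
proof -
  define A where "A = {s \<in> (SIGMA q:{q \<in> gauss_ints. q \<noteq> 0 \<and> gnorm q \<le> Q}. R q).
      \<exists>k\<in>gauss_ints. cmod (snd s / (fst s)\<^sup>2 + k - \<beta>) \<le> \<rho>}"
  have "\<forall>s\<in>A. \<exists>k. k \<in> gauss_ints \<and> cmod (snd s / (fst s)\<^sup>2 + k - \<beta>) \<le> \<rho>"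
    unfolding A_def by blast
  then obtain k where "\<forall>s\<in>A. k s \<in> gauss_ints \<and> cmod (snd s / (fst s)\<^sup>2 + k s - \<beta>) \<le> \<rho>"
    by (rule bchoice[THEN exE])
  then have k: "\<And>s. s \<in> A \<Longrightarrow> k s \<in> gauss_ints \<and> cmod (snd s / (fst s)\<^sup>2 + k s - \<beta>) \<le> \<rho>"
    by blast
  let ?f = "\<lambda>s. (fst s, snd s + (fst s)\<^sup>2 * k s)"
  have A_D: "fst s \<in> gauss_ints" "fst s \<noteq> 0" "gnorm (fst s) \<le> Q" "snd s \<in> R (fst s)"
    "reduced_residue_system (fst s) (R (fst s))" if "s \<in> A" for s
    using that R unfolding A_def by auto
  have inj: "inj_on ?f A"
  proof (rule inj_onI)
    fix s s' assume s: "s \<in> A" "s' \<in> A" and eq: "?f s = ?f s'"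
    then have q: "fst s' = fst s" and "snd s - snd s' = (fst s)\<^sup>2 * (k s' - k s)"
      by (auto simp: algebra_simps)
    then have "gcong (snd s) (snd s') ((fst s)\<^sup>2)" using k s by (auto simp: gcong_def)
    then have "snd s = snd s'"
      using A_D(4,5)[OF s(1)] A_D(4)[OF s(2)] q by (auto simp: reduced_residue_system_def)
    then show "s = s'" using q by (simp add: prod_eq_iff)
  qed
  have "?f ` A \<subseteq> square_fractions Q \<rho> \<beta>"
  proof (rule image_subsetI)
    fix s assume s: "s \<in> A"
    let ?q = "fst s" and ?a = "snd s"
    have a: "?a \<in> gauss_ints" "gcoprime ?a ?q"
      using A_D(4,5)[OF s] by (auto simp: reduced_residue_system_def)
    have "gcoprime (?a + ?q\<^sup>2 * k s) ?q"
      unfolding gcoprime_def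
    proof (intro ballI impI)
      fix d assume d: "d \<in> gauss_ints" "gdvd d (?a + ?q\<^sup>2 * k s) \<and> gdvd d ?q"
      have "gdvd d (?q * (?q * k s))" using d A_D(1)[OF s] k[OF s] by (intro gdvd_mult_right) auto
      then have "gdvd d ((?a + ?q\<^sup>2 * k s) - ?q * (?q * k s))" using d by (intro gdvd_diff) auto
      then have "gdvd d ?a" by (simp add: power2_eq_square)
      then show "gunit d" using a(2) d by (auto simp: gcoprime_def)
    qed
    moreover have "(?a + ?q\<^sup>2 * k s) / ?q\<^sup>2 = ?a / ?q\<^sup>2 + k s"
      using A_D(2)[OF s] by (simp add: field_simps)
    ultimately show "?f s \<in> square_fractions Q \<rho> \<beta>"
      using A_D[OF s] a k[OF s] by (simp add: square_fractions_def)
  qed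
  then show ?thesis unfolding A_def[symmetric] using inj finite_square_fractions by (intro card_inj_on_le)
qed

theorem theorem3:
  fixes \<epsilon> :: real
  assumes "\<epsilon> > 0"
  shows "\<exists>C>0. \<forall>(Q::nat) (N::nat) (c::complex \<Rightarrow> complex) (R::complex \<Rightarrow> complex set).
           Q \<ge> 1 \<longrightarrow> N \<ge> 1 \<longrightarrow>
           (\<forall>q\<in>gauss_ints. q \<noteq> 0 \<longrightarrow> reduced_residue_system q (R q)) \<longrightarrow>
           (\<Sum>q\<in>{q\<in>gauss_ints. q \<noteq> 0 \<and> gnorm q \<le> real Q}.
              \<Sum>a\<in>R q. (cmod (\<Sum>n\<in>{n\<in>gauss_ints. gnorm n \<le> real N}.
                                c n * ee (Re (n * a / q^2))))^2)
           \<le> C * (real Q * real N) powr \<epsilon> * (real Q ^ 3 + real Q ^ 2 * sqrt (real N) + real N)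
               * (\<Sum>n\<in>{n\<in>gauss_ints. gnorm n \<le> real N}. (cmod (c n))^2)"
proof -
  obtain K where K: "0 < K" "\<And>Q N \<rho> \<alpha>. 0 \<le> Q \<Longrightarrow> 1 \<le> N \<Longrightarrow> 0 < \<rho> \<Longrightarrow> \<rho>\<^sup>2 \<le> 16 / N \<Longrightarrow>
    real (card (square_fractions Q \<rho> \<alpha>)) \<le> K * N powr \<epsilon> * (1 + Q\<^sup>2 / sqrt N + Q ^ 3 / N)"
    using card_square_fractions[OF assms] by blast
  show ?thesis
  proof (intro exI[of _ "20736 * K"] conjI allI impI)
    show "0 < 20736 * K" using K(1) by simp
    fix Q N :: nat and c :: "complex \<Rightarrow> complex" and R :: "complex \<Rightarrow> complex set"
    assume Q: "1 \<le> Q" and N: "1 \<le> N"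
      and R: "\<forall>q\<in>gauss_ints. q \<noteq> 0 \<longrightarrow> reduced_residue_system q (R q)"
    let ?Qs = "{q \<in> gauss_ints. q \<noteq> 0 \<and> gnorm q \<le> real Q}"
    let ?B = "{n \<in> gauss_ints. gnorm n \<le> real N}"
    let ?Z = "\<Sum>n\<in>?B. (cmod (c n))\<^sup>2"
    define S where "S = (SIGMA q:?Qs. R q)"
    \<comment> \<open>This gives H^2 <= N <= 4 H^2; the second inequality turns the radius 2 / H
      into \<rho>^2 <= 16 / N.\<close>
    define H where "H = nat \<lfloor>sqrt N\<rfloor>"
    define P where "P = K * real N powr \<epsilon> * (1 + (real Q)\<^sup>2 / sqrt N + real Q ^ 3 / N)"
    have "1 \<le> sqrt N" using N by simp
    then have "1 \<le> \<lfloor>sqrt N\<rfloor>" "real H = of_int \<lfloor>sqrt N\<rfloor>" unfolding H_def by simp_all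
    then have H: "1 \<le> H" "real H \<le> sqrt N" "sqrt N \<le> 2 * real H" by linarith+
    have H2: "(real H)\<^sup>2 \<le> N" "real N \<le> 4 * (real H)\<^sup>2"
      using power_mono[OF H(2), of 2] power_mono[OF H(3), of 2] by (simp_all add: power_mult_distrib)
    have finQ: "finite ?Qs"
      by (rule finite_subset[OF _ finite_gauss_ball[of "sqrt Q"]])
         (auto simp: gnorm_eq_cmod intro: real_le_rsqrt)
    have finR: "\<forall>q\<in>?Qs. finite (R q)"
      using R finite_reduced_residue_system by blast
    have B: "?B \<subseteq> {n \<in> gauss_ints. \<bar>Re n\<bar> \<le> H \<and> \<bar>Im n\<bar> \<le> H}"
    proof clarify
      fix n assume n: "n \<in> gauss_ints" "gnorm n \<le> real N"
      \<comment> \<open>The coordinates are integers, so the bound sqrt N improves to its integer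
        part; this keeps H^2 <= N.\<close>
      have le: "\<bar>x\<bar> \<le> real H" if x: "x \<in> \<int>" "\<bar>x\<bar> \<le> cmod n" for x
      proof -
        have "cmod n \<le> sqrt N" using n(2) by (intro real_le_rsqrt) (simp add: gnorm_eq_cmod)
        moreover obtain i where i: "x = of_int i" using x(1) by (rule Ints_cases)
        ultimately have "real_of_int \<bar>i\<bar> \<le> sqrt N" using x(2) by simp
        then have "\<bar>i\<bar> \<le> \<lfloor>sqrt N\<rfloor>" by (simp add: le_floor_iff)
        then show ?thesis unfolding i H_def by linarith
      qed
      show "\<bar>Re n\<bar> \<le> real H \<and> \<bar>Im n\<bar> \<le> real H"
        using n(1) le abs_Re_le_cmod abs_Im_le_cmod by (simp add: gauss_ints_def)
    qed
    have count: "real (card {s \<in> S. \<exists>k\<in>gauss_ints. cmod (snd s / (fst s)\<^sup>2 + k - \<beta>) \<le> 2 / H}) \<le> P" for \<beta>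
    proof -
      have "(2 / real H)\<^sup>2 \<le> 16 / N"
        using H2(2) H(1) N by (simp add: power_divide field_simps)
      then have "real (card (square_fractions Q (2 / H) \<beta>)) \<le> P"
        unfolding P_def using H(1) N by (intro K(2)) auto
      moreover have "card {s \<in> S. \<exists>k\<in>gauss_ints. cmod (snd s / (fst s)\<^sup>2 + k - \<beta>) \<le> 2 / H}
          \<le> card (square_fractions Q (2 / H) \<beta>)"
        unfolding S_def using R by (intro card_residues_near_le) blast
      ultimately show ?thesis by linarith
    qed
    have P0: "0 \<le> P" using K(1) by (simp add: P_def)
    have Z0: "0 \<le> ?Z" by (intro sum_nonneg) auto
    have "(\<Sum>q\<in>?Qs. \<Sum>a\<in>R q. (cmod (\<Sum>n\<in>?B. c n * ee (Re (n * a / q^2))))^2)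
        = (\<Sum>s\<in>S. (cmod (\<Sum>n\<in>?B. c n * ee (Re (n * (snd s / (fst s)\<^sup>2)))))\<^sup>2)"
      unfolding S_def sum.Sigma[OF finQ finR] by (simp only: split_def times_divide_eq_right)
    also have "\<dots> \<le> 20736 * P * (real H)\<^sup>2 * ?Z"
      using finQ finR unfolding S_def
      by (intro gauss_large_sieve[OF _ H(1) B count[unfolded S_def]] finite_SigmaI) auto
    also have "\<dots> \<le> 20736 * P * real N * ?Z"
      using H2(1) P0 Z0 by (intro mult_right_mono mult_left_mono) auto
    also have "\<dots> = 20736 * K * real N powr \<epsilon> * (real Q ^ 3 + real Q ^ 2 * sqrt (real N) + real N) * ?Z"
    proof -
      have "real N / sqrt N = sqrt N" by (rule real_div_sqrt) simp
      moreover have "(real Q)\<^sup>2 / sqrt N * real N = (real Q)\<^sup>2 * (real N / sqrt N)" by simp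
      moreover have "real Q ^ 3 / N * real N = real Q ^ 3" using N by simp
      ultimately have "(1 + (real Q)\<^sup>2 / sqrt N + real Q ^ 3 / N) * real N
          = real Q ^ 3 + real Q ^ 2 * sqrt (real N) + real N"
        by (simp only: distrib_right mult_1 add_ac)
      then show ?thesis unfolding P_def by (simp only: mult.assoc)
    qed
    also have "\<dots> \<le> 20736 * K * (real Q * real N) powr \<epsilon> * (real Q ^ 3 + real Q ^ 2 * sqrt (real N) + real N) * ?Z"
    proof -
      \<comment> \<open>The argument loses only N^\<epsilon>; Q >= 1 gives the weaker form that is
        claimed.\<close>
      have "real N powr \<epsilon> \<le> (real Q * real N) powr \<epsilon>"
        using Q assms by (intro powr_mono2) (auto simp: mult_le_cancel_right1)
      then show ?thesis using K(1) Z0 by (intro mult_right_mono mult_left_mono) auto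
    qed
    finally show "(\<Sum>q\<in>?Qs. \<Sum>a\<in>R q. (cmod (\<Sum>n\<in>?B. c n * ee (Re (n * a / q^2))))^2)
        \<le> 20736 * K * (real Q * real N) powr \<epsilon> * (real Q ^ 3 + real Q ^ 2 * sqrt (real N) + real N) * ?Z" .
  qed
qed

end
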